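(* For every integer $s\ge2$, every $0<\alpha<1$, and all sufficiently large $n$, there exists a binary $k$-PIR code $[N,n,k]^P$ with redundancy $r=N-n$ such that $$k=\Theta\Big(\big(\tfrac{n}{\log n}\big)^{(1-\frac1s)\frac{1-\alpha}{1+\alpha}}\Big),\qquad r=\mathcal{O}\Big(n^{1-\frac{\alpha}{s(1+\alpha)}}(\log n)^{\frac{\alpha}{s(1+\alpha)}}\Big).$$ In particular, for $0\le\epsilon<1$: $r_P\big(n,k=\Omega(n^{\epsilon^-})\big)=\mathcal{O}\big(n^{\delta(\epsilon)^+}\big)$, where $\delta(\epsilon)=\min_{s\in\mathbb{Z},\,s>\frac1{1-\epsilon}}\delta_s(\epsilon)$ and $\delta_s(\epsilon)=1-\frac{s(1-\epsilon)-1}{2s(s-1)}$; and $r_P\big(n,k=\Theta(n^\epsilon)\big)=o(n)$.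
   Context: A binary $[N,n,k]^P$ code ($k$-PIR code) is a binary linear code of length $N$ encoding $n$ information bits such that for every information bit $x_i$ there exist $k$ mutually disjoint sets $R_{i,1},\dots,R_{i,k}\subseteq\{1,\dots,N\}$ such that, for each $j$, $x_i$ is a function of the codeword bits indexed by $R_{i,j}$. Its redundancy is $N-n$. $r_P(n,k)$ denotes the minimum redundancy $N-n$ of a binary $[N,n,k]^P$ code. Notation: $f(n)=\Omega(n^{a^-})$ means $f(n)=\Omega(n^{a-\tau})$ for all $\tau>0$, and $f(n)=\mathcal{O}(n^{a^+})$ means $f(n)=\mathcal{O}(n^{a+\tau})$ for all $\tau>0$; the statement $r_P(n,k=\Omega(n^{\epsilon^-}))=\mathcal{O}(n^{\delta^+})$ means that there exist binary $k$-PIR codes of dimension $n$ with $k=\Omega(n^{\epsilon^-})$ and redundancy $\mathcal{O}(n^{\delta^+})$. Logarithms are to base 2. *)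

theory Defs
  imports Complex_Main "HOL-Library.Landau_Symbols"
begin

text \<open>Binary linear codes of length N with n information bits.  Messages are
  bit vectors x :: nat \<Rightarrow> bool supported on {..<n}.  The code is given by a
  generator matrix over GF(2), described column by column: column j (j < N)
  is the set G j \<subseteq> {..<n} of rows with entry 1; codeword bit j is the
  GF(2)-sum (parity) of the message bits indexed by G j.\<close>

definition messages :: "nat \<Rightarrow> (nat \<Rightarrow> bool) set" where
  "messages n = {x. \<forall>i\<ge>n. \<not> x i}"

definition encode :: "(nat \<Rightarrow> nat set) \<Rightarrow> (nat \<Rightarrow> bool) \<Rightarrow> nat \<Rightarrow> bool" where
  "encode G x j = odd (card {i \<in> G j. x i})"

definition recovers :: "nat \<Rightarrow> (nat \<Rightarrow> nat set) \<Rightarrow> nat \<Rightarrow> nat set \<Rightarrow> bool" where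
  "recovers n G i R \<longleftrightarrow>
     (\<forall>x\<in>messages n. \<forall>y\<in>messages n.
        (\<forall>j\<in>R. encode G x j = encode G y j) \<longrightarrow> x i = y i)"

definition is_PIR_code :: "nat \<Rightarrow> nat \<Rightarrow> nat \<Rightarrow> (nat \<Rightarrow> nat set) \<Rightarrow> bool" where
  "is_PIR_code N n k G \<longleftrightarrow>
     (\<forall>j<N. G j \<subseteq> {..<n}) \<and>
     (\<forall>x\<in>messages n. \<forall>y\<in>messages n. (\<forall>j<N. encode G x j = encode G y j) \<longrightarrow> x = y) \<and>
     (\<forall>i<n. \<exists>R :: nat \<Rightarrow> nat set.
        (\<forall>t<k. R t \<subseteq> {..<N} \<and> recovers n G i (R t)) \<and>
        (\<forall>t<k. \<forall>t'<k. t \<noteq> t' \<longrightarrow> R t \<inter> R t' = {}))"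

definition has_PIR_code :: "nat \<Rightarrow> nat \<Rightarrow> nat \<Rightarrow> bool" where
  "has_PIR_code N n k \<longleftrightarrow> (\<exists>G. is_PIR_code N n k G)"

definition delta_s :: "nat \<Rightarrow> real \<Rightarrow> real" where
  "delta_s s \<epsilon> = 1 - (real s * (1 - \<epsilon>) - 1) / (2 * real s * (real s - 1))"

text \<open>delta(eps) = min over integers s > 1/(1-eps) of delta_s(eps)
  (such s are automatically \<ge> 2, so natural numbers suffice).\<close>
definition delta :: "real \<Rightarrow> real" where
  "delta \<epsilon> = Inf {delta_s s \<epsilon> | s. real s > 1 / (1 - \<epsilon>)}"

end

theory Submission
  imports Defs "HOL-Algebra.Algebraic_Closure_Type" "HOL-Real_Asymp.Real_Asymp"
begin

text \<open>The codes are binary images of multiplicity codes.  Let \<open>F\<close> be the field with \<open>q = 2 ^ l\<close>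
  elements.  A codeword lists, at all points of \<open>F ^ s\<close>, the Hasse derivatives of order less than
  \<open>m\<close> of a polynomial in \<open>s\<close> variables of degree less than \<open>m (q - 1)\<close>, and each element of \<open>F\<close> is
  written with \<open>l\<close> bits.  On a line through a point \<open>a\<close> the polynomial is determined by its
  derivatives at the other \<open>q - 1\<close> points.  The derivatives at \<open>a\<close> are in turn determined by the
  restrictions to the lines with directions \<open>(1, b)\<close>, where \<open>b\<close> ranges over a grid of side \<open>m\<close>.
  Disjoint grids give \<open>(q div m) ^ (s - 1)\<close> disjoint recovery sets, while the redundancy is smaller
  than the length by a factor of order \<open>m\<close>.  The theorem results from \<open>m = q powr \<alpha>\<close>.\<close>

subsection \<open>Binary linear codes with disjoint recovery sets\<close>

text \<open>Low redundancy has this reason: pairs of a point and an order outnumber the exponents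
  only through the orders whose sum is within \<open>s\<close> of \<open>m\<close>. There are at
  most \<open>s * m ^ (s - 1)\<close> of these, while all orders together number
  \<open>m ^ s\<close> up to constants depending on \<open>s\<close>. The obstacle is injectivity of
  the encoding: degrees reach beyond \<open>q\<close>, so vanishing on \<open>F ^ s\<close> does not
  make a polynomial zero. For this reason \<open>F\<close> is placed inside an algebraically closed
  field. The restriction to a line is zero as a polynomial, so it may be evaluated outside
  \<open>F\<close>, where a grid large enough for degrees up to \<open>m * q\<close> is available.
  Parameters, up to constants depending on \<open>s\<close> and \<alpha>: the dimension is
  \<open>log q * (q * m) ^ s\<close>, so \<open>m = q powr \<alpha>\<close> puts \<open>q\<close> at
  \<open>(n / log n) powr (1 / (s * (1 + \<alpha>)))\<close>. The exponents in the theorem are those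
  of \<open>(q / m) ^ (s - 1)\<close> and of \<open>n / m\<close>. Dimensions between those of two
  such codes are reached by shortening.\<close>

lemma has_PIR_code_mono:
  assumes "has_PIR_code N n k" and "k' \<le> k"
  shows "has_PIR_code N n k'"
proof -
  obtain G where G: "is_PIR_code N n k G"
    using assms(1) unfolding has_PIR_code_def by blast
  have "is_PIR_code N n k' G"
    unfolding is_PIR_code_def
  proof (intro conjI allI impI)
    fix i assume "i < n"
    then obtain R :: "nat \<Rightarrow> nat set" where
      R: "\<forall>t<k. R t \<subseteq> {..<N} \<and> recovers n G i (R t)"
         "\<forall>t<k. \<forall>t'<k. t \<noteq> t' \<longrightarrow> R t \<inter> R t' = {}"
      using G unfolding is_PIR_code_def by blast
    show "\<exists>R. (\<forall>t<k'. R t \<subseteq> {..<N} \<and> recovers n G i (R t)) \<and>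
              (\<forall>t<k'. \<forall>t'<k'. t \<noteq> t' \<longrightarrow> R t \<inter> R t' = {})"
      using R assms(2) by (intro exI[of _ R] conjI allI impI) auto
  qed (use G in \<open>auto simp: is_PIR_code_def\<close>)
  then show ?thesis
    unfolding has_PIR_code_def by blast
qed

text \<open>Take a largest \<open>T\<close> on which every pattern is realised by a codeword. If a
  nonempty codeword \<open>D\<close> missed \<open>T\<close>, any \<open>j\<close> in
  \<open>D\<close> could join \<open>T\<close>, because adding \<open>D\<close> flips
  \<open>j\<close> and keeps the pattern on \<open>T\<close>. Hence restriction to \<open>T\<close>
  is injective as well.\<close>

lemma exists_information_set:
  assumes "finite J" and sub: "C \<subseteq> Pow J" and "{} \<in> C"
    and sd: "\<And>A B. A \<in> C \<Longrightarrow> B \<in> C \<Longrightarrow> sym_diff A B \<in> C"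
  obtains T where "T \<subseteq> J" and "bij_betw (\<lambda>A. A \<inter> T) C (Pow T)"
proof -
  define good where "good T \<longleftrightarrow> T \<subseteq> J \<and> (\<forall>Z\<subseteq>T. \<exists>A\<in>C. A \<inter> T = Z)" for T
  have "good {}"
    using \<open>{} \<in> C\<close> by (auto simp: good_def)
  moreover have "card T \<le> card J" if "good T" for T
    using that \<open>finite J\<close> by (auto simp: good_def intro: card_mono)
  ultimately have "\<exists>T. good T \<and> (\<forall>T'. good T' \<longrightarrow> card T' \<le> card T)"
    using ex_has_greatest_nat[of good "{}" card "Suc (card J)"] by (simp add: less_Suc_eq_le)
  then obtain T where T: "good T" and max: "\<And>T'. good T' \<Longrightarrow> card T' \<le> card T"
    by blast
  have "T \<subseteq> J" and surj: "\<And>Z. Z \<subseteq> T \<Longrightarrow> \<exists>A\<in>C. A \<inter> T = Z"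
    using T by (auto simp: good_def)
  have fin: "finite T"
    using \<open>T \<subseteq> J\<close> \<open>finite J\<close> by (rule finite_subset)
  have inj0: "D = {}" if D: "D \<in> C" "D \<inter> T = {}" for D
  proof (rule ccontr)
    assume "D \<noteq> {}"
    then obtain j where j: "j \<in> D" "j \<in> J" "j \<notin> T"
      using D sub by blast
    have "good (insert j T)"
      unfolding good_def
    proof (intro conjI allI impI)
      fix Z assume Z: "Z \<subseteq> insert j T"
      obtain A where A: "A \<in> C" "A \<inter> T = Z - {j}"
        using surj[of "Z - {j}"] Z by blast
      show "\<exists>A\<in>C. A \<inter> insert j T = Z"
      proof (cases "j \<in> A \<longleftrightarrow> j \<in> Z")
        case True
        then show ?thesis using A Z j by (intro bexI[of _ A]) auto
      next
        case False
        then show ?thesis using A Z j D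
          by (intro bexI[of _ "sym_diff A D"] sd) auto
      qed
    qed (use j \<open>T \<subseteq> J\<close> in auto)
    from max[OF this] show False
      using fin j by simp
  qed
  have "inj_on (\<lambda>A. A \<inter> T) C"
  proof (rule inj_onI)
    fix A B assume AB: "A \<in> C" "B \<in> C" "A \<inter> T = B \<inter> T"
    have "sym_diff A B = {}"
      by (rule inj0) (use AB sd in auto)
    then show "A = B" by blast
  qed
  moreover have "(\<lambda>A. A \<inter> T) ` C = Pow T"
  proof
    show "Pow T \<subseteq> (\<lambda>A. A \<inter> T) ` C"
      using surj by (metis PowD image_eqI subsetI)
  qed auto
  ultimately show ?thesis
    using that[OF \<open>T \<subseteq> J\<close>] by (simp add: bij_betw_def)
qed

text \<open>A binary linear code is given by its codewords, viewed as subsets of the set \<open>J\<close> of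
  coordinates.  The generator is systematic on an information set, and \<open>K - n\<close> of
  the information bits are set to zero and dropped (shortening), which keeps the redundancy.\<close>

lemma has_PIR_code_if_disjoint_recovery:
  assumes "finite J" and sub: "C \<subseteq> Pow J" and "{} \<in> C"
    and sd: "\<And>A B. A \<in> C \<Longrightarrow> B \<in> C \<Longrightarrow> sym_diff A B \<in> C"
    and card: "card C = 2 ^ K" and "n \<le> K"
    and rec: "\<And>j. j \<in> J \<Longrightarrow> \<exists>R. disjoint_family_on R Q \<and>
                (\<forall>g\<in>Q. \<forall>A\<in>C. A \<inter> R g = {} \<longrightarrow> j \<notin> A)"
    and Q: "finite Q"
  shows "has_PIR_code (n + (card J - K)) n (card Q)"
proof -
  obtain T where "T \<subseteq> J" and bij: "bij_betw (\<lambda>A. A \<inter> T) C (Pow T)"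
    using exists_information_set[OF assms(1-4)] by blast
  have fin: "finite T"
    using \<open>T \<subseteq> J\<close> \<open>finite J\<close> by (rule finite_subset)
  have "2 ^ card T = (2 ^ K :: nat)"
    using bij_betw_same_card[OF bij] card fin by (simp add: card_Pow)
  then have cT: "card T = K" by simp
  then have "K \<le> card J"
    using card_mono[OF \<open>finite J\<close> \<open>T \<subseteq> J\<close>] by simp
  obtain T' where T': "T' \<subseteq> T" "card T' = n"
    using \<open>n \<le> K\<close> cT obtain_subset_with_card_n by metis
  have finT': "finite T'"
    using T' fin finite_subset by blast
  define J' where "J' = J - (T - T')"
  define N where "N = n + (card J - K)"
  have J': "finite J'" "J' \<subseteq> J" "T' \<subseteq> J'"
    using \<open>finite J\<close> T' \<open>T \<subseteq> J\<close> by (auto simp: J'_def)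
  have "card J' = card J - card (T - T')"
    unfolding J'_def using \<open>T \<subseteq> J\<close> fin by (intro card_Diff_subset) auto
  also have "card (T - T') = K - n"
    using card_Diff_subset[OF finT' T'(1)] cT T'(2) by simp
  finally have cJ': "card J' = N"
    using \<open>K \<le> card J\<close> \<open>n \<le> K\<close> by (simp add: N_def)
  obtain \<sigma> where \<sigma>: "bij_betw \<sigma> {..<N} J'"
    using ex_bij_betw_nat_finite[OF J'(1)] cJ' by (auto simp: atLeast0LessThan)
  obtain \<tau> where \<tau>: "bij_betw \<tau> {..<n} T'"
    using ex_bij_betw_nat_finite[OF finT'] T'(2) by (auto simp: atLeast0LessThan)
  have "\<forall>i\<in>{..<n}. \<exists>A. A \<in> C \<and> A \<inter> T = {\<tau> i}"
  proof
    fix i assume "i \<in> {..<n}"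
    then have "{\<tau> i} \<in> Pow T"
      using \<tau> T' by (auto simp: bij_betw_def)
    then have "{\<tau> i} \<in> (\<lambda>A. A \<inter> T) ` C"
      using bij by (simp add: bij_betw_def)
    then show "\<exists>A. A \<in> C \<and> A \<inter> T = {\<tau> i}" by fastforce
  qed
  from bchoice[OF this] obtain c
    where c: "\<And>i. i < n \<Longrightarrow> c i \<in> C" "\<And>i. i < n \<Longrightarrow> c i \<inter> T = {\<tau> i}"
    by auto
  define G where "G j = {i \<in> {..<n}. \<sigma> j \<in> c i}" for j
  \<comment> \<open>The GF(2)-sum of the generators \<open>c i\<close> with \<open>i < M\<close> and
    \<open>x i\<close>. The bound \<open>M\<close> serves the induction that shows
    \<open>w n x\<close> to be a codeword.\<close>
  define w where "w M x = {j\<in>J. odd (card {i \<in> {..<M}. x i \<and> j \<in> c i})}"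
    for M :: nat and x :: "nat \<Rightarrow> bool"
  have wC: "w M x \<in> C" if "M \<le> n" for M x
    using that
  proof (induction M)
    case 0
    then show ?case using \<open>{} \<in> C\<close> by (simp add: w_def)
  next
    case (Suc M)
    have eq: "{i \<in> {..<Suc M}. x i \<and> j \<in> c i} =
        (if x M \<and> j \<in> c M then insert M {i \<in> {..<M}. x i \<and> j \<in> c i} else {i \<in> {..<M}. x i \<and> j \<in> c i})"
      for j by (auto simp: less_Suc_eq)
    have "c M \<subseteq> J"
      using c(1)[of M] Suc.prems sub by auto
    then have "w (Suc M) x = (if x M then sym_diff (w M x) (c M) else w M x)"
      unfolding w_def eq by auto
    then show ?case
      using Suc.IH Suc.prems c(1)[of M] sd[of "w M x" "c M"] by simp
  qed
  have enc: "encode G x j \<longleftrightarrow> \<sigma> j \<in> w n x" if "j < N" for x j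
  proof -
    have "\<sigma> j \<in> J"
      using \<sigma> that J' by (auto simp: bij_betw_def)
    moreover have "{i \<in> G j. x i} = {i \<in> {..<n}. x i \<and> \<sigma> j \<in> c i}"
      by (auto simp: G_def)
    ultimately show ?thesis
      by (simp add: encode_def w_def)
  qed
  have wT: "u \<in> w n x \<longleftrightarrow> (\<exists>i<n. u = \<tau> i \<and> x i)" if u: "u \<in> T" for u x
  proof (cases "u \<in> T'")
    case True
    then obtain i where i: "i < n" "u = \<tau> i"
      using \<tau> by (auto simp: bij_betw_def)
    have inj: "\<tau> i = \<tau> i' \<longleftrightarrow> i = i'" if "i' < n" for i'
      using \<tau> i that by (auto simp: bij_betw_def inj_on_def)
    have "{i' \<in> {..<n}. x i' \<and> u \<in> c i'} = (if x i then {i} else {})"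
      using c(2) u i inj by (auto simp: set_eq_iff)
    then show ?thesis
      using u i \<open>T \<subseteq> J\<close> inj by (auto simp: w_def)
  next
    case False
    then have no: "u \<noteq> \<tau> i" if "i < n" for i
      using \<tau> that by (auto simp: bij_betw_def)
    then have none: "{i' \<in> {..<n}. x i' \<and> u \<in> c i'} = {}"
      using c(2) u by (auto simp: set_eq_iff)
    have "u \<notin> w n x"
      unfolding w_def mem_Collect_eq none by simp
    then show ?thesis
      using no by blast
  qed
  have w\<tau>: "\<tau> i \<in> w n x \<longleftrightarrow> x i" if "i < n" for i x
  proof -
    have "\<tau> i \<in> T"
      using \<tau> that T'(1) by (auto simp: bij_betw_def)
    moreover have "\<tau> i = \<tau> i' \<longleftrightarrow> i = i'" if "i' < n" for i'
      using \<tau> \<open>i < n\<close> that by (auto simp: bij_betw_def inj_on_def)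
    ultimately show ?thesis
      using wT[of "\<tau> i" x] that by auto
  qed
  have "is_PIR_code N n (card Q) G"
    unfolding is_PIR_code_def
  proof (intro conjI allI impI ballI)
    fix x y assume xy: "x \<in> messages n" "y \<in> messages n" "\<forall>j<N. encode G x j = encode G y j"
    show "x = y"
    proof
      fix i
      show "x i = y i"
      proof (cases "i < n")
        case True
        then have "\<tau> i \<in> J'"
          using \<tau> J' by (auto simp: bij_betw_def)
        then obtain j where "j < N" "\<sigma> j = \<tau> i"
          using \<sigma> bij_betw_imp_surj_on by (metis imageE lessThan_iff)
        then show ?thesis
          using xy(3) enc[of j x] enc[of j y] w\<tau>[OF True] by simp
      qed (use xy in \<open>auto simp: messages_def\<close>)
    qed
  next
    fix i assume i: "i < n"
    then have \<tau>i: "\<tau> i \<in> T'" "\<tau> i \<in> J"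
      using \<tau> J' by (auto simp: bij_betw_def)
    obtain R where dis: "disjoint_family_on R Q"
      and R: "\<And>g A. g \<in> Q \<Longrightarrow> A \<in> C \<Longrightarrow> A \<inter> R g = {} \<Longrightarrow> \<tau> i \<notin> A"
      using rec[OF \<tau>i(2)] by blast
    obtain h where h: "bij_betw h {..<card Q} Q"
      using ex_bij_betw_nat_finite[OF Q] by (auto simp: atLeast0LessThan)
    \<comment> \<open>A recovery set of the long code may use dropped coordinates in
      \<open>T - T'\<close>. All shortened codewords vanish there, so nothing is lost by leaving
      them out.\<close>
    define R' where "R' t = {j \<in> {..<N}. \<sigma> j \<in> R (h t)}" for t
    have "recovers n G i (R' t)" if t: "t < card Q" for t
      unfolding recovers_def
    proof (intro ballI impI)
      fix x y assume eq: "\<forall>j\<in>R' t. encode G x j = encode G y j"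
      let ?A = "sym_diff (w n x) (w n y)"
      have A: "?A \<in> C"
        using wC by (intro sd) auto
      have "u \<notin> R (h t)" if u: "u \<in> ?A" for u
      proof
        assume uR: "u \<in> R (h t)"
        have "u \<in> J" using A sub u by blast
        have "u \<in> J'"
        proof (rule ccontr)
          assume "u \<notin> J'"
          then have "u \<in> T" "u \<notin> T'" using \<open>u \<in> J\<close> by (auto simp: J'_def)
          then show False
            using u wT[of u x] wT[of u y] \<tau> by (auto simp: bij_betw_def)
        qed
        then obtain j where j: "j < N" "\<sigma> j = u"
          using \<sigma> by (auto simp: bij_betw_def)
        then have "j \<in> R' t" using uR by (simp add: R'_def)
        then show False
          using eq enc[OF j(1)] j(2) u by auto
      qed
      then have "\<tau> i \<notin> ?A"
        using h t by (intro R[of "h t"] A) (auto simp: bij_betw_def)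
      then show "x i = y i"
        using w\<tau>[OF i] by auto
    qed
    moreover have "R' t \<inter> R' t' = {}" if "t < card Q" "t' < card Q" "t \<noteq> t'" for t t'
    proof -
      have "h t \<in> Q" "h t' \<in> Q" "h t \<noteq> h t'"
        using h that by (auto simp: bij_betw_def inj_on_def)
      then show ?thesis
        using dis by (auto simp: R'_def disjoint_family_on_def)
    qed
    ultimately show "\<exists>R. (\<forall>t<card Q. R t \<subseteq> {..<N} \<and> recovers n G i (R t)) \<and>
        (\<forall>t<card Q. \<forall>t'<card Q. t \<noteq> t' \<longrightarrow> R t \<inter> R t' = {})"
      by (intro exI[of _ R']) (auto simp: R'_def)
  qed (auto simp: G_def)
  then show ?thesis
    unfolding has_PIR_code_def N_def by blast
qed

subsection \<open>Polynomials on grids and lines\<close>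

lemma sum_PiE_insert:
  assumes "x \<notin> I"
  shows "(\<Sum>c\<in>PiE (insert x I) B. f c) = (\<Sum>y\<in>B x. \<Sum>c\<in>PiE I B. f (c(x := y)))"
proof -
  have "(\<Sum>c\<in>PiE (insert x I) B. f c) = (\<Sum>(y, c)\<in>B x \<times> PiE I B. f (c(x := y)))"
    unfolding PiE_insert_eq using inj_combinator[OF assms, of B]
    by (subst sum.reindex) (auto simp: case_prod_unfold)
  then show ?thesis
    by (simp add: sum.cartesian_product)
qed

text \<open>Induction on the variables. With the others fixed at \<open>v\<close>, the sum is a
  polynomial in the variable \<open>x\<close> of degree below \<open>M\<close> with at least
  \<open>M\<close> roots. So each of its coefficients, a sum of the same shape in fewer variables,
  vanishes at every \<open>v\<close> of the smaller grid.\<close>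

lemma eq_zero_if_vanishes_on_grid:
  fixes h :: "('i \<Rightarrow> nat) \<Rightarrow> 'a :: idom"
  assumes "finite I" and "\<And>i. i \<in> I \<Longrightarrow> finite (S i)" and "\<And>i. i \<in> I \<Longrightarrow> M \<le> card (S i)"
    and "\<And>v. v \<in> PiE I S \<Longrightarrow> (\<Sum>c\<in>PiE I (\<lambda>_. {..<M}). h c * (\<Prod>i\<in>I. v i ^ c i)) = 0"
    and "c \<in> PiE I (\<lambda>_. {..<M})"
  shows "h c = 0"
  using assms
proof (induction I arbitrary: h c rule: finite_induct)
  case empty
  then show ?case by simp
next
  case (insert x I)
  define E where "E = PiE I (\<lambda>_. {..<M})"
  define j where "j = c x"
  define c' where "c' = c(x := undefined)"
  have j: "j < M" and c': "c' \<in> E" and c: "c = c'(x := j)"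
    using insert.prems(4) insert.hyps by (auto simp: E_def j_def c'_def PiE_iff extensional_def)
  have vanish: "(\<Sum>c\<in>E. h (c(x := j)) * (\<Prod>i\<in>I. v i ^ c i)) = 0" if v: "v \<in> PiE I S" for v
  proof -
    define g where "g j = (\<Sum>c\<in>E. h (c(x := j)) * (\<Prod>i\<in>I. v i ^ c i))" for j
    define p where "p = (\<Sum>j<M. monom (g j) j)"
    have root: "poly p y = 0" if y: "y \<in> S x" for y
    proof -
      have "v(x := y) \<in> PiE (insert x I) S"
        using v y by (auto simp: PiE_iff extensional_def)
      then have "0 = (\<Sum>c\<in>PiE (insert x I) (\<lambda>_. {..<M}). h c * (\<Prod>i\<in>insert x I. (v(x := y)) i ^ c i))"
        by (rule insert.prems(3)[symmetric])
      also have "\<dots> = (\<Sum>j<M. \<Sum>c\<in>E. h (c(x := j)) *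
          (\<Prod>i\<in>insert x I. (v(x := y)) i ^ (c(x := j)) i))"
        by (simp only: sum_PiE_insert[OF insert.hyps(2)] E_def)
      also have "\<dots> = (\<Sum>j<M. \<Sum>c\<in>E. h (c(x := j)) * (y ^ j * (\<Prod>i\<in>I. v i ^ c i)))"
      proof (intro sum.cong refl)
        fix j :: nat and c :: "'i \<Rightarrow> nat"
        have "(\<Prod>i\<in>I. (v(x := y)) i ^ (c(x := j)) i) = (\<Prod>i\<in>I. v i ^ c i)"
          using insert.hyps by (intro prod.cong) auto
        then show "h (c(x := j)) * (\<Prod>i\<in>insert x I. (v(x := y)) i ^ (c(x := j)) i) =
            h (c(x := j)) * (y ^ j * (\<Prod>i\<in>I. v i ^ c i))"
          using insert.hyps by simp
      qed
      also have "\<dots> = poly p y"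
        by (simp add: p_def g_def poly_sum poly_monom sum_distrib_left mult_ac)
      finally show ?thesis by simp
    qed
    have "p = 0"
    proof (rule ccontr)
      assume "p \<noteq> 0"
      then have "card (S x) \<le> card {y. poly p y = 0}"
        using root by (intro card_mono poly_roots_finite) auto
      also have "\<dots> \<le> degree p"
        using \<open>p \<noteq> 0\<close> by (rule card_poly_roots_bound)
      also have "degree p < M"
        unfolding p_def using j
        by (intro degree_sum_less) (auto intro: le_less_trans[OF degree_monom_le])
      finally show False
        using insert.prems(2)[of x] by simp
    qed
    moreover have "coeff p j = g j"
      using j by (simp add: p_def coeff_sum)
    ultimately show ?thesis
      by (simp add: g_def)
  qed
  have "h (c'(x := j)) = 0"
  proof (rule insert.IH[of "\<lambda>c. h (c(x := j))"])
    show "c' \<in> PiE I (\<lambda>_. {..<M})" using c' by (simp add: E_def)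
  qed (use insert.prems vanish in \<open>auto simp: E_def\<close>)
  then show ?case by (simp only: c)
qed

section \<open>Finite fields of characteristic 2 and their binary coordinates\<close>

lemma sum_sym_diff_char2:
  fixes Z Y :: "'a :: ab_group_add set"
  assumes "\<And>x :: 'a. x + x = 0" and "finite Z" and "finite Y"
  shows "sum id (sym_diff Z Y) = sum id Z + sum id Y"
proof -
  have "sum id Z = sum id (Z - Y) + sum id (Z \<inter> Y)" "sum id Y = sum id (Y - Z) + sum id (Z \<inter> Y)"
    using assms sum.Int_Diff[of Z id Y] sum.Int_Diff[of Y id Z]
    by (simp_all add: add.commute Int_commute)
  then have "sum id Z + sum id Y = sum id (Z - Y) + sum id (Y - Z) + (sum id (Z \<inter> Y) + sum id (Z \<inter> Y))"
    by (simp only: add_ac)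
  also have "\<dots> = sum id (Z - Y) + sum id (Y - Z)"
    using assms(1) by simp
  also have "\<dots> = sum id (sym_diff Z Y)"
    using assms by (intro sum.union_disjoint[symmetric]) auto
  finally show ?thesis by simp
qed

text \<open>\<open>B\<close> is a basis over GF(2), found as a largest subset of \<open>F\<close>
  with pairwise distinct subset sums, and \<open>\<rho> x\<close> is the set of basis elements that
  sum to \<open>x\<close>. Coordinates as subsets turn addition into symmetric difference, the form
  in which codes are given above.\<close>

lemma exists_binary_coordinates:
  fixes F :: "'a :: ab_group_add set"
  assumes dbl: "\<And>x :: 'a. x + x = 0" and "finite F" and "0 \<in> F"
    and add: "\<And>x y. x \<in> F \<Longrightarrow> y \<in> F \<Longrightarrow> x + y \<in> F"
  shows "\<exists>(B :: 'a set) \<rho>. finite B \<and> card F = 2 ^ card B \<and> (\<forall>x\<in>F. \<rho> x \<subseteq> B) \<and>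
    (\<forall>x\<in>F. \<forall>y\<in>F. \<rho> (x + y) = sym_diff (\<rho> x) (\<rho> y)) \<and> (\<forall>x\<in>F. \<rho> x = {} \<longleftrightarrow> x = 0)"
proof -
  define good where "good B \<longleftrightarrow> B \<subseteq> F \<and> inj_on (sum id) (Pow B)" for B :: "'a set"
  have "good {}"
    by (auto simp: good_def)
  moreover have "card B \<le> card F" if "good B" for B
    using that \<open>finite F\<close> by (auto simp: good_def intro: card_mono)
  ultimately have "\<exists>B. good B \<and> (\<forall>B'. good B' \<longrightarrow> card B' \<le> card B)"
    using ex_has_greatest_nat[of good "{}" card "Suc (card F)"] by (simp add: less_Suc_eq_le)
  then obtain B where "good B" and max: "\<And>B'. good B' \<Longrightarrow> card B' \<le> card B"
    by blast
  then have "B \<subseteq> F" and inj: "inj_on (sum id) (Pow B)"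
    by (auto simp: good_def)
  have fin: "finite B"
    using \<open>B \<subseteq> F\<close> \<open>finite F\<close> by (rule finite_subset)
  have fin': "finite Z" if "Z \<subseteq> B" for Z
    using that fin by (rule finite_subset)
  have "sum id Z \<in> F" if "Z \<subseteq> B" for Z
    using fin'[OF that] that
  proof (induction Z rule: finite_induct)
    case (insert x Z)
    then show ?case using add \<open>B \<subseteq> F\<close> by auto
  qed (use \<open>0 \<in> F\<close> in auto)
  moreover have "x \<in> (sum id) ` Pow B" if "x \<in> F" for x
  proof (rule ccontr)
    assume x: "x \<notin> (sum id) ` Pow B"
    have "x \<notin> B"
    proof
      assume "x \<in> B"
      then have "{x} \<in> Pow B" "x = sum id {x}" by auto
      then show False using x by (metis image_eqI)
    qed
    have ins: "sum id Z = x + sum id (Z - {x})" if "Z \<subseteq> insert x B" "x \<in> Z" for Z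
      using that fin sum.remove[of Z x id] by (auto intro: finite_subset)
    have ne: "x + sum id Z \<noteq> sum id Y" if "Z \<subseteq> B" "Y \<subseteq> B" for Z Y
    proof
      assume "x + sum id Z = sum id Y"
      then have "x = sum id Y + sum id Z"
        using dbl[of "sum id Z"] by (metis add.assoc add.right_neutral)
      also have "\<dots> = sum id (sym_diff Y Z)"
        using fin' that by (intro sum_sym_diff_char2[symmetric] dbl) auto
      finally show False
        using x that by blast
    qed
    have "inj_on (sum id) (Pow (insert x B))"
    proof (rule inj_onI)
      fix Z Y assume ZY: "Z \<in> Pow (insert x B)" "Y \<in> Pow (insert x B)" "sum id Z = sum id Y"
      have sub: "Z - {x} \<subseteq> B" "Y - {x} \<subseteq> B" using ZY by auto
      have iff: "x \<in> Z \<longleftrightarrow> x \<in> Y"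
      proof (rule ccontr)
        assume "\<not> (x \<in> Z \<longleftrightarrow> x \<in> Y)"
        then consider "x \<in> Z" "x \<notin> Y" | "x \<notin> Z" "x \<in> Y" by blast
        then show False
        proof cases
          case 1
          then have "Y - {x} = Y" by blast
          then show False
            using ne[OF sub] ins[of Z] ZY 1 by (metis PowD)
        next
          case 2
          then have "Z - {x} = Z" by blast
          then show False
            using ne[OF sub(2) sub(1)] ins[of Y] ZY 2 by (metis PowD)
        qed
      qed
      have "sum id (Z - {x}) = sum id (Y - {x})"
      proof (cases "x \<in> Z")
        case True
        then show ?thesis
          using ins[of Z] ins[of Y] ZY iff by (metis PowD add_left_cancel)
      next
        case False
        then have "Z - {x} = Z" "Y - {x} = Y" using iff by auto
        then show ?thesis using ZY by metis
      qed
      then have "Z - {x} = Y - {x}"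
        using inj sub by (auto simp: inj_on_def)
      then show "Z = Y" using iff by blast
    qed
    then have "good (insert x B)"
      using \<open>B \<subseteq> F\<close> \<open>x \<in> F\<close> by (simp add: good_def)
    then show False
      using max[of "insert x B"] \<open>x \<notin> B\<close> fin by simp
  qed
  ultimately have bij: "bij_betw (sum id) (Pow B) F"
    using inj by (auto simp: bij_betw_def)
  define \<rho> where "\<rho> = the_inv_into (Pow B) (sum id)"
  have \<rho>: "\<rho> x \<subseteq> B" "sum id (\<rho> x) = x" if "x \<in> F" for x
    using that bij the_inv_into_into[OF inj, of x] f_the_inv_into_f[OF inj, of x]
    by (auto simp: \<rho>_def bij_betw_def)
  have \<rho>I: "\<rho> x = Z" if "Z \<subseteq> B" "sum id Z = x" for x Z
    using that the_inv_into_f_f[OF inj, of Z] by (simp add: \<rho>_def)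
  show ?thesis
  proof (intro exI conjI ballI)
    show "card F = 2 ^ card B"
      using bij_betw_same_card[OF bij] fin by (simp add: card_Pow)
    show "\<rho> (x + y) = sym_diff (\<rho> x) (\<rho> y)" if "x \<in> F" "y \<in> F" for x y
    proof (rule \<rho>I)
      show "sym_diff (\<rho> x) (\<rho> y) \<subseteq> B" using \<rho>(1) that by blast
      show "sum id (sym_diff (\<rho> x) (\<rho> y)) = x + y"
        using sum_sym_diff_char2[of "\<rho> x" "\<rho> y", OF dbl] \<rho> fin' that by simp
    qed
    show "\<rho> x = {} \<longleftrightarrow> x = 0" if "x \<in> F" for x
      using \<rho>(2)[OF that] \<rho>I[of "{}"] by auto
  qed (use fin \<rho> in auto)
qed

text \<open>The polynomial \<open>X ^ q - X\<close> splits into \<open>q\<close> linear factors, and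
  its derivative is the constant -1, so no root is repeated.\<close>

lemma card_frobenius_fixed_points:
  assumes "prime CHAR('a :: alg_closed_field)" and "l > 0"
  defines "q \<equiv> CHAR('a) ^ l"
  shows "card {x :: 'a. x ^ q = x} = q"
proof -
  have q: "q > 1"
    unfolding q_def using prime_gt_1_nat[OF assms(1)] assms(2) by (rule one_less_power)
  define p :: "'a poly" where "p = monom 1 q - [:0, 1:]"
  have deg: "degree p = q"
    using degree_add_eq_left[of "- [:0, 1:]" "monom (1 :: 'a) q"] q
    by (simp only: p_def degree_monom_eq diff_conv_add_uminus) (simp add: degree_monom_eq)
  then have "p \<noteq> 0" using q by auto
  have "coeff p q = 1"
    using q by (auto simp: p_def coeff_pCons split: nat.splits)
  with alg_closed_imp_factorization[OF \<open>p \<noteq> 0\<close>] deg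
  obtain A where A: "size A = q" "p = (\<Prod>x\<in>#A. [:-x, 1:])"
    by auto
  have der: "pderiv p = -1"
  proof -
    have "(of_nat q :: 'a) = 0"
      using assms(2) unfolding q_def of_nat_power of_nat_CHAR by simp
    then show ?thesis
      by (simp add: p_def pderiv_diff pderiv_monom pderiv_pCons one_pCons)
  qed
  have "count A x \<le> 1" for x
  proof (rule ccontr)
    assume "\<not> count A x \<le> 1"
    then have "{#x, x#} \<subseteq># A"
      by (auto simp: subseteq_mset_def)
    then obtain A' where "A = {#x, x#} + A'"
      by (metis subset_mset.add_diff_inverse)
    then obtain r where "p = [:-x, 1:] * ([:-x, 1:] * r)"
      using A(2) by (auto simp: mult.assoc)
    then have "poly (pderiv p) x = 0"
      by (simp only: pderiv_mult poly_add poly_mult) simp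
    then show False using der by simp
  qed
  then have "count A x = 1" if "x \<in># A" for x
    using that by (metis count_eq_zero_iff le_neq_implies_less less_one)
  then have "count A x = count (mset_set (set_mset A)) x" for x
    by (cases "x \<in># A") (auto simp: count_mset_set' not_in_iff)
  then have "A = mset_set (set_mset A)"
    by (rule multiset_eqI)
  then have "card (set_mset A) = q"
    using A(1) by (metis size_mset_set)
  moreover have "set_mset A = {x. x ^ q = x}"
  proof -
    have "x \<in># A \<longleftrightarrow> poly p x = 0" for x
      unfolding A(2) by (auto simp: poly_prod_mset prod_mset_zero_iff)
    then show ?thesis
      by (auto simp: p_def poly_monom)
  qed
  ultimately show ?thesis by simp
qed

section \<open>Hasse derivatives and restrictions to lines\<close>

lemma pcompose_power: "pcompose (p ^ n) r = pcompose p r ^ n"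
  by (induction n) (simp_all add: pcompose_mult pcompose_1)

lemma smult_sum_right: "smult c (\<Sum>i\<in>A. p i) = (\<Sum>i\<in>A. smult c (p i))"
  by (induction A rule: infinite_finite_induct) (simp_all add: smult_add_right)

text \<open>The sum runs to a common bound \<open>M\<close> instead of \<open>c\<close>, so that a
  product over several variables expands over one fixed box of exponents. The added binomials are
  0.\<close>

lemma linear_poly_power:
  fixes a v :: "'a :: comm_ring_1"
  assumes "c < M"
  shows "[:a, v:] ^ c = (\<Sum>e<M. monom (of_nat (c choose e) * a ^ (c - e) * v ^ e) e)"
proof -
  have "[:a, v:] ^ c = (monom v 1 + [:a:]) ^ c"
    by (simp add: monom_altdef)
  also have "\<dots> = (\<Sum>e\<le>c. of_nat (c choose e) * monom v 1 ^ e * [:a:] ^ (c - e))"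
    by (rule binomial_ring)
  also have "\<dots> = (\<Sum>e\<le>c. monom (of_nat (c choose e) * a ^ (c - e) * v ^ e) e)"
  proof (intro sum.cong refl)
    fix e
    have "of_nat (c choose e) * monom v 1 ^ e * [:a:] ^ (c - e) =
        [:of_nat (c choose e):] * monom (v ^ e) e * [:a ^ (c - e):]"
      by (simp add: monom_power of_nat_poly poly_const_pow)
    also have "\<dots> = monom (of_nat (c choose e) * a ^ (c - e) * v ^ e) e"
      by (simp add: smult_monom mult_ac)
    finally show "of_nat (c choose e) * monom v 1 ^ e * [:a:] ^ (c - e) =
        monom (of_nat (c choose e) * a ^ (c - e) * v ^ e) e" .
  qed
  also have "\<dots> = (\<Sum>e<M. monom (of_nat (c choose e) * a ^ (c - e) * v ^ e) e)"
    using assms by (intro sum.mono_neutral_left) (auto simp: binomial_eq_0)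
  finally show ?thesis .
qed

lemma prod_monom:
  "(\<Prod>i\<in>A. monom (c i) (e i)) = monom (\<Prod>i\<in>A. c i :: 'a :: comm_semiring_1) (\<Sum>i\<in>A. e i)"
  by (induction A rule: infinite_finite_induct) (auto simp: mult_monom one_pCons monom_0)

text \<open>A polynomial in the variables \<open>i < s\<close> is a coefficient function \<open>f\<close> on
  a finite set \<open>D\<close> of exponents.  \<open>hasse s D f e a\<close> is its Hasse derivative of order \<open>e\<close> at \<open>a\<close>,
  and \<open>line_poly s D f a v\<close> is its restriction \<open>f(a + t v)\<close> to a line, as a polynomial in \<open>t\<close>.\<close>

definition hasse :: "nat \<Rightarrow> (nat \<Rightarrow> nat) set \<Rightarrow> ((nat \<Rightarrow> nat) \<Rightarrow> 'a :: comm_ring_1) \<Rightarrow>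
    (nat \<Rightarrow> nat) \<Rightarrow> (nat \<Rightarrow> 'a) \<Rightarrow> 'a" where
  "hasse s D f e a = (\<Sum>c\<in>D. f c * (\<Prod>i<s. of_nat (c i choose e i) * a i ^ (c i - e i)))"

definition line_poly :: "nat \<Rightarrow> (nat \<Rightarrow> nat) set \<Rightarrow> ((nat \<Rightarrow> nat) \<Rightarrow> 'a :: comm_ring_1) \<Rightarrow>
    (nat \<Rightarrow> 'a) \<Rightarrow> (nat \<Rightarrow> 'a) \<Rightarrow> 'a poly" where
  "line_poly s D f a v = (\<Sum>c\<in>D. smult (f c) (\<Prod>i<s. [:a i, v i:] ^ c i))"

lemma hasse_cong: "(\<And>i. i < s \<Longrightarrow> a i = a' i) \<Longrightarrow> hasse s D f e a = hasse s D f e a'"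
  by (simp add: hasse_def)

text \<open>Taylor's formula along a line. Hasse derivatives absorb the factorials, so it holds over
  every commutative ring, in particular in characteristic 2.\<close>

lemma line_poly_expand:
  assumes "D \<subseteq> {..<s} \<rightarrow>\<^sub>E {..<M}"
  shows "line_poly s D f a v =
    (\<Sum>e\<in>{..<s} \<rightarrow>\<^sub>E {..<M}. monom (hasse s D f e a * (\<Prod>i<s. v i ^ e i)) (\<Sum>i<s. e i))"
proof -
  have "(\<Prod>i<s. [:a i, v i:] ^ c i) = (\<Sum>e\<in>{..<s} \<rightarrow>\<^sub>E {..<M}.
      monom ((\<Prod>i<s. of_nat (c i choose e i) * a i ^ (c i - e i)) * (\<Prod>i<s. v i ^ e i)) (\<Sum>i<s. e i))"
    if "c \<in> D" for c
  proof -
    have "(\<Prod>i<s. [:a i, v i:] ^ c i) =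
        (\<Prod>i<s. \<Sum>e<M. monom (of_nat (c i choose e) * a i ^ (c i - e) * v i ^ e) e)"
      using that assms by (intro prod.cong linear_poly_power) auto
    also have "\<dots> = (\<Sum>e\<in>{..<s} \<rightarrow>\<^sub>E {..<M}.
        \<Prod>i<s. monom (of_nat (c i choose e i) * a i ^ (c i - e i) * v i ^ e i) (e i))"
      by (intro prod_sum_PiE) auto
    finally show ?thesis
      by (simp only: prod_monom prod.distrib)
  qed
  then have "line_poly s D f a v = (\<Sum>c\<in>D. \<Sum>e\<in>{..<s} \<rightarrow>\<^sub>E {..<M}.
      monom (f c * (\<Prod>i<s. of_nat (c i choose e i) * a i ^ (c i - e i)) * (\<Prod>i<s. v i ^ e i)) (\<Sum>i<s. e i))"
    by (simp add: line_poly_def smult_sum_right smult_monom mult.assoc)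
  also have "\<dots> = (\<Sum>e\<in>{..<s} \<rightarrow>\<^sub>E {..<M}. \<Sum>c\<in>D.
      monom (f c * (\<Prod>i<s. of_nat (c i choose e i) * a i ^ (c i - e i)) * (\<Prod>i<s. v i ^ e i)) (\<Sum>i<s. e i))"
    by (rule sum.swap)
  finally show ?thesis
    by (simp only: hasse_def sum_distrib_right monom_sum)
qed

lemma coeff_line_poly:
  assumes "D \<subseteq> {..<s} \<rightarrow>\<^sub>E {..<M}"
  shows "coeff (line_poly s D f a v) j =
    (\<Sum>e | e \<in> ({..<s} \<rightarrow>\<^sub>E {..<M}) \<and> (\<Sum>i<s. e i) = j. hasse s D f e a * (\<Prod>i<s. v i ^ e i))"
proof -
  have "finite ({..<s} \<rightarrow>\<^sub>E {..<M})"
    by (intro finite_PiE) auto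
  then show ?thesis
    unfolding line_poly_expand[OF assms] coeff_sum coeff_monom
    by (simp add: sum.inter_filter)
qed

lemma pcompose_line_poly:
  "pcompose (line_poly s D f a v) [:t, 1:] = line_poly s D f (\<lambda>i. a i + t * v i) v"
proof -
  have "pcompose (\<Prod>i<s. [:a i, v i:] ^ c i) [:t, 1:] = (\<Prod>i<s. [:a i + t * v i, v i:] ^ c i)" for c
    by (simp add: pcompose_prod pcompose_power pcompose_pCons mult.commute)
  then show ?thesis
    by (simp add: line_poly_def pcompose_sum pcompose_smult)
qed

lemma poly_line_poly:
  "poly (line_poly s D f a v) t = (\<Sum>c\<in>D. f c * (\<Prod>i<s. (a i + t * v i) ^ c i))"
  by (simp add: line_poly_def poly_sum poly_prod)

lemma degree_line_poly:
  assumes "\<And>c. c \<in> D \<Longrightarrow> (\<Sum>i<s. c i) < d" and "d > 0"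
  shows "degree (line_poly s D f a v) < d"
  unfolding line_poly_def
proof (intro degree_sum_less)
  fix c assume c: "c \<in> D"
  have "degree (smult (f c) (\<Prod>i<s. [:a i, v i:] ^ c i)) \<le> degree (\<Prod>i<s. [:a i, v i:] ^ c i)"
    by (rule degree_smult_le)
  also have "\<dots> \<le> (\<Sum>i<s. degree ([:a i, v i:] ^ c i))"
    by (rule degree_prod_sum_le[unfolded o_def]) simp
  also have "\<dots> \<le> (\<Sum>i<s. c i)"
  proof (rule sum_mono)
    fix i
    have "degree ([:a i, v i:] ^ c i) \<le> degree [:a i, v i:] * c i"
      by (rule degree_power_le)
    also have "\<dots> \<le> 1 * c i"
      by (rule mult_right_mono) auto
    finally show "degree ([:a i, v i:] ^ c i) \<le> c i" by simp
  qed
  also have "\<dots> < d"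
    using assms(1)[OF c] .
  finally show "degree (smult (f c) (\<Prod>i<s. [:a i, v i:] ^ c i)) < d" .
qed (use assms in auto)

text \<open>Moving the base point to parameter \<open>t\<close> turns divisibility into the
  vanishing of the coefficients below \<open>m\<close>. By Taylor's formula these are combinations
  of derivatives of order less than \<open>m\<close>. Shifting back by \<open>-t\<close> gives the
  factor.\<close>

lemma power_dvd_line_poly:
  fixes f :: "(nat \<Rightarrow> nat) \<Rightarrow> 'a :: idom"
  assumes D: "D \<subseteq> {..<s} \<rightarrow>\<^sub>E {..<M}"
    and "\<And>e. e \<in> {..<s} \<rightarrow>\<^sub>E {..<M} \<Longrightarrow> (\<Sum>i<s. e i) < m \<Longrightarrow> hasse s D f e (\<lambda>i. a i + t * v i) = 0"
  shows "[:-t, 1:] ^ m dvd line_poly s D f a v"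
proof -
  have "coeff (line_poly s D f (\<lambda>i. a i + t * v i) v) j = 0" if "j < m" for j
    unfolding coeff_line_poly[OF D] by (rule sum.neutral) (use that assms in auto)
  then have "monom 1 m dvd pcompose (line_poly s D f a v) [:t, 1:]"
    by (simp add: pcompose_line_poly monom_1_dvd_iff')
  then obtain r where r: "pcompose (line_poly s D f a v) [:t, 1:] = monom 1 m * r"
    by (elim dvdE)
  have "line_poly s D f a v = pcompose (pcompose (line_poly s D f a v) [:t, 1:]) [:-t, 1:]"
    by (simp add: pcompose_assoc[symmetric] pcompose_pCons)
  also have "\<dots> = [:-t, 1:] ^ m * pcompose r [:-t, 1:]"
    by (simp add: r pcompose_mult monom_altdef pcompose_power pcompose_pCons)
  finally show ?thesis
    by (metis dvd_triv_left)
qed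

lemma eq_zero_if_powers_dvd:
  fixes p :: "'a :: field poly"
  assumes "finite S" and "\<And>t. t \<in> S \<Longrightarrow> [:-t, 1:] ^ m dvd p" and "degree p < m * card S"
  shows "p = 0"
proof (rule ccontr)
  assume "p \<noteq> 0"
  have "m > 0" using assms(3) by (cases m) auto
  have ord: "m \<le> order t p" if "t \<in> S" for t
    using assms(2)[OF that] \<open>p \<noteq> 0\<close> by (simp add: order_divides)
  have "m * card S \<le> (\<Sum>t\<in>S. order t p)"
    using sum_mono[of S "\<lambda>_. m" "\<lambda>t. order t p"] ord by (simp add: mult.commute)
  also have "\<dots> \<le> (\<Sum>t | poly p t = 0. order t p)"
    using ord \<open>m > 0\<close> \<open>p \<noteq> 0\<close>
    by (intro sum_mono2 poly_roots_finite) (force simp: order_root)+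
  also have "\<dots> \<le> degree p"
    using \<open>p \<noteq> 0\<close> by (rule sum_order_le_degree)
  finally show False using assms(3) by simp
qed

subsection \<open>Counting exponents\<close>

lemma finite_exponents: "finite {u \<in> {..<s :: nat} \<rightarrow>\<^sub>E {..<m :: nat}. P u}"
  by (rule finite_subset[of _ "{..<s} \<rightarrow>\<^sub>E {..<m}"]) (auto intro: finite_PiE)

text \<open>Once the sum is fixed, the last entry is determined by the other
  \<open>s - 1\<close>.\<close>

lemma card_exponents_sum_eq_le:
  assumes "s \<ge> 1"
  shows "card {u \<in> {..<s} \<rightarrow>\<^sub>E {..<m}. (\<Sum>i<s. u i) = j} \<le> m ^ (s - 1)"
proof -
  let ?A = "{u \<in> {..<s} \<rightarrow>\<^sub>E {..<m}. (\<Sum>i<s. u i) = j}"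
  obtain r where r: "s = Suc r" using assms by (cases s) auto
  have "inj_on (\<lambda>u. restrict u {..<r}) ?A"
  proof (rule inj_onI)
    fix u v assume uv: "u \<in> ?A" "v \<in> ?A" "restrict u {..<r} = restrict v {..<r}"
    have eq: "u i = v i" if "i < r" for i
      using fun_cong[OF uv(3), of i] that by simp
    then have "(\<Sum>i<r. u i) = (\<Sum>i<r. v i)" by simp
    moreover have "(\<Sum>i<s. u i) = (\<Sum>i<s. v i)" using uv by simp
    ultimately have "u r = v r" by (simp add: r)
    then have "u i = v i" if "i \<in> {..<s}" for i
      using eq that by (auto simp: r less_Suc_eq)
    then show "u = v"
      using uv by (intro PiE_ext[of u "{..<s}" "\<lambda>_. {..<m}" v]) auto
  qed
  moreover have "(\<lambda>u. restrict u {..<r}) ` ?A \<subseteq> {..<r} \<rightarrow>\<^sub>E {..<m}"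
    unfolding r by (intro image_subsetI restrict_PiE_iff[THEN iffD2]) (auto simp: PiE_iff)
  ultimately have "card ?A \<le> card ({..<r} \<rightarrow>\<^sub>E {..<m})"
    by (intro card_inj_on_le[of "\<lambda>u. restrict u {..<r}"] finite_PiE) simp_all
  then show ?thesis by (simp add: card_PiE r)
qed

lemma card_exponents_small_sum_ge:
  assumes "s \<ge> 1" and "2 * s \<le> m"
  shows "(real m / (2 * real s)) ^ s \<le> card {u \<in> {..<s} \<rightarrow>\<^sub>E {..<m}. (\<Sum>i<s. u i) + s < m}"
proof -
  \<comment> \<open>The largest side of a cube inside the simplex:
    \<open>s * (b - 1) + s < m\<close>. Since \<open>2 * s \<le> m\<close>, at least
    \<open>m / 2\<close> of the bound is left after subtracting \<open>s\<close>, which gives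
    \<open>b\<close> at least \<open>m / (2 * s)\<close>.\<close>
  define b where "b = (m - s - 1) div s + 1"
  have "real m / (2 * real s) \<le> real b"
  proof -
    have "m - s - 1 < s * b"
      using dividend_less_times_div[of s "m - s - 1"] assms by (simp add: b_def algebra_simps)
    then have "m - s \<le> s * b" using assms by linarith
    then have "m \<le> 2 * (s * b)" using assms by linarith
    then have "real m \<le> 2 * (real s * real b)"
      by (metis of_nat_le_iff of_nat_mult of_nat_numeral)
    then show ?thesis using assms by (simp add: field_simps)
  qed
  then have "(real m / (2 * real s)) ^ s \<le> real b ^ s"
    by (intro power_mono) auto
  also have "real b ^ s = card ({..<s} \<rightarrow>\<^sub>E {..<b})"
    by (simp add: card_PiE)
  also have "\<dots> \<le> card {u \<in> {..<s} \<rightarrow>\<^sub>E {..<m}. (\<Sum>i<s. u i) + s < m}"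
  proof -
    have "{..<s} \<rightarrow>\<^sub>E {..<b} \<subseteq> {u \<in> {..<s} \<rightarrow>\<^sub>E {..<m}. (\<Sum>i<s. u i) + s < m}"
    proof
      fix u assume u: "u \<in> {..<s} \<rightarrow>\<^sub>E {..<b}"
      have ub: "u i < b" if "i < s" for i
        using u that by (auto simp: PiE_iff)
      have "(\<Sum>i<s. u i) \<le> (\<Sum>i<s. b - 1)"
      proof (rule sum_mono)
        fix i assume "i \<in> {..<s}"
        then show "u i \<le> b - 1" using ub[of i] by simp
      qed
      also have "\<dots> = s * ((m - s - 1) div s)" by (simp add: b_def)
      also have "\<dots> \<le> m - s - 1" by (rule times_div_less_eq_dividend)
      finally have lt: "(\<Sum>i<s. u i) + s < m" using assms by linarith
      have "b \<le> m"
      proof -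
        have "(m - s - 1) div s \<le> m - s - 1" by (rule div_le_dividend)
        then show ?thesis using assms unfolding b_def by linarith
      qed
      then have "u \<in> {..<s} \<rightarrow>\<^sub>E {..<m}"
        using u ub by (auto simp: PiE_iff intro: less_le_trans)
      then show "u \<in> {u \<in> {..<s} \<rightarrow>\<^sub>E {..<m}. (\<Sum>i<s. u i) + s < m}"
        using lt by blast
    qed
    then show ?thesis
      by (intro of_nat_mono card_mono finite_exponents)
  qed
  finally show ?thesis .
qed

text \<open>The sum takes at most \<open>s\<close> values here. These are the orders that
  \<open>card_exponents_degree_ge\<close> does not match with exponents, and this thin layer alone
  will bound the redundancy.\<close>

lemma card_exponents_large_sum_le:
  assumes "s \<ge> 1"
  shows "card {u \<in> {..<s} \<rightarrow>\<^sub>E {..<m}. (\<Sum>i<s. u i) < m \<and> m \<le> (\<Sum>i<s. u i) + s} \<le> s * m ^ (s - 1)"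
proof -
  have "{u \<in> {..<s} \<rightarrow>\<^sub>E {..<m}. (\<Sum>i<s. u i) < m \<and> m \<le> (\<Sum>i<s. u i) + s} \<subseteq>
      (\<Union>j\<in>{m - s..<m}. {u \<in> {..<s} \<rightarrow>\<^sub>E {..<m}. (\<Sum>i<s. u i) = j})"
    by auto
  then have "card {u \<in> {..<s} \<rightarrow>\<^sub>E {..<m}. (\<Sum>i<s. u i) < m \<and> m \<le> (\<Sum>i<s. u i) + s} \<le>
      card (\<Union>j\<in>{m - s..<m}. {u \<in> {..<s} \<rightarrow>\<^sub>E {..<m}. (\<Sum>i<s. u i) = j})"
    by (intro card_mono finite_UN_I finite_exponents) auto
  also have "\<dots> \<le> (\<Sum>j\<in>{m - s..<m}. card {u \<in> {..<s} \<rightarrow>\<^sub>E {..<m}. (\<Sum>i<s. u i) = j})"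
    by (rule card_UN_le) simp
  also have "\<dots> \<le> (\<Sum>j\<in>{m - s..<m}. m ^ (s - 1))"
    by (intro sum_mono card_exponents_sum_eq_le assms)
  also have "\<dots> = (m - (m - s)) * m ^ (s - 1)"
    by simp
  also have "\<dots> \<le> s * m ^ (s - 1)"
    by (rule mult_right_mono) auto
  finally show ?thesis .
qed

text \<open>Writing exponents in the form \<open>q u + r\<close> with \<open>r < q\<close> compares the polynomials of degree
  less than \<open>m (q - 1)\<close> with the pairs of a point and a derivative of order less than \<open>m\<close>.\<close>

lemma card_exponents_degree_ge:
  assumes "s \<ge> 1" and "1 \<le> m" and "m \<le> q"
  shows "q ^ s * card {u \<in> {..<s} \<rightarrow>\<^sub>E {..<m}. (\<Sum>i<s. u i) + s < m} \<le>
    card {c \<in> {..<s} \<rightarrow>\<^sub>E {..<m * q}. (\<Sum>i<s. c i) < m * (q - 1)}"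
proof -
  let ?U = "{u \<in> {..<s} \<rightarrow>\<^sub>E {..<m}. (\<Sum>i<s. u i) + s < m}"
  let ?D = "{c \<in> {..<s} \<rightarrow>\<^sub>E {..<m * q}. (\<Sum>i<s. c i) < m * (q - 1)}"
  define \<phi> where "\<phi> = (\<lambda>(r, u). restrict (\<lambda>i. q * u i + r i :: nat) {..<s})"
  have "inj_on \<phi> (({..<s} \<rightarrow>\<^sub>E {..<q}) \<times> ?U)"
  proof (rule inj_onI, clarify)
    fix r u r' u'
    assume r: "r \<in> {..<s} \<rightarrow>\<^sub>E {..<q}" "r' \<in> {..<s} \<rightarrow>\<^sub>E {..<q}"
      and u: "u \<in> {..<s} \<rightarrow>\<^sub>E {..<m}" "u' \<in> {..<s} \<rightarrow>\<^sub>E {..<m}" and eq: "\<phi> (r, u) = \<phi> (r', u')"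
    have "r i = r' i \<and> u i = u' i" if i: "i \<in> {..<s}" for i
    proof -
      have e: "q * u i + r i = q * u' i + r' i"
        using fun_cong[OF eq, of i] i by (simp add: \<phi>_def)
      have lt: "r i < q" "r' i < q" using r i by (auto simp: PiE_iff)
      have "r i = r' i"
        using arg_cong[OF e, of "\<lambda>x. x mod q"] lt by simp
      then show ?thesis using e lt by simp
    qed
    then show "r = r' \<and> u = u'"
      using PiE_ext[OF r] PiE_ext[OF u] by simp
  qed
  moreover have "\<phi> ` (({..<s} \<rightarrow>\<^sub>E {..<q}) \<times> ?U) \<subseteq> ?D"
  proof (clarify, intro conjI)
    fix r u
    assume r: "r \<in> {..<s} \<rightarrow>\<^sub>E {..<q}" and u: "u \<in> {..<s} \<rightarrow>\<^sub>E {..<m}"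
      and su: "(\<Sum>i<s. u i) + s < m"
    have "q * u i + r i < m * q" if "i < s" for i
    proof -
      have "u i + 1 \<le> m" "r i < q" using r u that by (auto simp: PiE_iff Suc_le_eq)
      then have "q * u i + r i < q * (u i + 1)" by simp
      also have "\<dots> \<le> q * m" using \<open>u i + 1 \<le> m\<close> by (intro mult_left_mono) auto
      finally show ?thesis by (simp add: mult.commute)
    qed
    then show "\<phi> (r, u) \<in> {..<s} \<rightarrow>\<^sub>E {..<m * q}"
      by (auto simp: \<phi>_def PiE_iff)
    have "(\<Sum>i<s. \<phi> (r, u) i) = (\<Sum>i<s. q * u i + r i)"
      by (simp add: \<phi>_def)
    \<comment> \<open>Each remainder costs less than one further \<open>q\<close>; this is the
      origin of the slack \<open>s\<close> in the condition on \<open>u\<close>.\<close>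
    also have "\<dots> < (\<Sum>i<s. q * u i + q)"
      using r assms(1) by (intro sum_strict_mono) (auto simp: PiE_iff lessThan_empty_iff)
    also have "\<dots> = q * ((\<Sum>i<s. u i) + s)"
      by (simp add: sum.distrib sum_distrib_left algebra_simps)
    also have "\<dots> \<le> q * (m - 1)"
      using su by (intro mult_left_mono) auto
    \<comment> \<open>That is, \<open>q * m - q \<le> q * m - m\<close>, by
      \<open>m \<le> q\<close>.\<close>
    also have "\<dots> \<le> m * (q - 1)"
      using assms by (simp add: algebra_simps diff_mult_distrib)
    finally show "(\<Sum>i<s. \<phi> (r, u) i) < m * (q - 1)" .
  qed
  ultimately have "card (({..<s} \<rightarrow>\<^sub>E {..<q}) \<times> ?U) \<le> card ?D"
    by (intro card_inj_on_le[of \<phi>] finite_exponents)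
  then show ?thesis
    by (simp add: card_cartesian_product card_PiE)
qed

subsection \<open>Multiplicity codes\<close>

text \<open>The field is a proper subset \<open>F\<close> of an ambient field instead of a type: its
  size can then vary with \<open>n\<close>, and a parameter outside \<open>F\<close> is available
  for \<open>eq_zero_if_derivs_vanish\<close>.\<close>

locale multiplicity_code =
  fixes F :: "'a :: field set" and q s m :: nat
  assumes card_F: "card F = q" and q: "2 \<le> q"
    and zero: "0 \<in> F" and one: "1 \<in> F"
    and add: "\<And>x y. x \<in> F \<Longrightarrow> y \<in> F \<Longrightarrow> x + y \<in> F"
    and mult: "\<And>x y. x \<in> F \<Longrightarrow> y \<in> F \<Longrightarrow> x * y \<in> F"
    and inverse: "\<And>x. x \<in> F \<Longrightarrow> inverse x \<in> F"
    and double: "\<And>x :: 'a. x + x = 0"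
    and proper: "F \<noteq> UNIV"
    and s: "1 \<le> s" and m: "1 \<le> m" "m \<le> q"
begin

definition points :: "(nat \<Rightarrow> 'a) set" where
  "points = {..<s} \<rightarrow>\<^sub>E F"

definition orders :: "(nat \<Rightarrow> nat) set" where
  "orders = {u \<in> {..<s} \<rightarrow>\<^sub>E {..<m}. (\<Sum>i<s. u i) < m}"

text \<open>The degree bound is the number of zeros, counted with multiplicity \<open>m\<close>,
  that \<open>q - 1\<close> points of a line supply. The side \<open>m * q\<close> of the box is at
  most \<open>q * q\<close>, the side of the grid in
  \<open>eq_zero_if_derivs_vanish\<close>.\<close>

definition exponents :: "(nat \<Rightarrow> nat) set" where
  "exponents = {c \<in> {..<s} \<rightarrow>\<^sub>E {..<m * q}. (\<Sum>i<s. c i) < m * (q - 1)}"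

definition line_point :: "(nat \<Rightarrow> 'a) \<Rightarrow> 'a \<Rightarrow> (nat \<Rightarrow> 'a) \<Rightarrow> nat \<Rightarrow> 'a" where
  "line_point a t v = restrict (\<lambda>i. a i + t * v i) {..<s}"

abbreviation deriv_at :: "((nat \<Rightarrow> nat) \<Rightarrow> 'a) \<Rightarrow> (nat \<Rightarrow> nat) \<Rightarrow> (nat \<Rightarrow> 'a) \<Rightarrow> 'a" where
  "deriv_at f \<equiv> hasse s exponents f"

abbreviation line :: "((nat \<Rightarrow> nat) \<Rightarrow> 'a) \<Rightarrow> (nat \<Rightarrow> 'a) \<Rightarrow> (nat \<Rightarrow> 'a) \<Rightarrow> 'a poly" where
  "line f \<equiv> line_poly s exponents f"

lemma finite_F: "finite F"
  using card_F q by (intro card_ge_0_finite) simp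

lemma diff: "x \<in> F \<Longrightarrow> y \<in> F \<Longrightarrow> x - y \<in> F"
  using add[of x y] double by (metis add_diff_cancel_left' diff_add_cancel add.assoc)

lemma exponents_subset: "exponents \<subseteq> {..<s} \<rightarrow>\<^sub>E {..<m * q}"
  by (auto simp: exponents_def)

lemma finite_exponents_set: "finite exponents"
  unfolding exponents_def by (rule finite_exponents)

text \<open>Entries are bounded by the sum, so passing to the larger box, over which the Taylor
  expansions of \<open>line\<close> run, adds no orders.\<close>

lemma in_orders_iff:
  "e \<in> orders \<longleftrightarrow> e \<in> {..<s} \<rightarrow>\<^sub>E {..<m * q} \<and> (\<Sum>i<s. e i) < m"
proof -
  have "m \<le> m * q" using q by simp
  moreover have "e i \<le> (\<Sum>i<s. e i)" if "i < s" for i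
    using that by (intro member_le_sum) auto
  ultimately show ?thesis
    unfolding orders_def PiE_iff by (auto intro: less_le_trans le_less_trans)
qed

lemma deriv_at_line_point: "deriv_at f e (line_point a t v) = deriv_at f e (\<lambda>i. a i + t * v i)"
  by (rule hasse_cong) (simp add: line_point_def)

lemma line_point_in_points:
  assumes "a \<in> points" and "\<And>i. i < s \<Longrightarrow> v i \<in> F" and "t \<in> F"
  shows "line_point a t v \<in> points"
  using assms add mult by (auto simp: points_def line_point_def PiE_iff)

lemma sum_in_F: "(\<And>x. x \<in> A \<Longrightarrow> g x \<in> F) \<Longrightarrow> sum g A \<in> F"
  by (induction A rule: infinite_finite_induct) (auto intro: zero add)

lemma prod_in_F: "(\<And>x. x \<in> A \<Longrightarrow> g x \<in> F) \<Longrightarrow> prod g A \<in> F"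
  by (induction A rule: infinite_finite_induct) (auto intro: one mult)

lemma power_in_F: "x \<in> F \<Longrightarrow> x ^ n \<in> F"
  by (induction n) (auto intro: one mult)

lemma of_nat_in_F: "of_nat n \<in> F"
  by (induction n) (auto intro: zero one add)

lemma deriv_at_in_F:
  assumes "f \<in> exponents \<rightarrow>\<^sub>E F" and "a \<in> points"
  shows "deriv_at f e a \<in> F"
  unfolding hasse_def using assms
  by (intro sum_in_F mult prod_in_F power_in_F of_nat_in_F) (auto simp: points_def)

lemma deriv_at_add:
  "deriv_at (restrict (\<lambda>c. f c + g c) exponents) e a = deriv_at f e a + deriv_at g e a"
  by (simp add: hasse_def algebra_simps sum.distrib)

text \<open>Every \<open>t\<close> in \<open>S\<close> is a zero of multiplicity at least
  \<open>m\<close>, too many for a degree below \<open>m * (q - 1)\<close>. \<open>S\<close> is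
  \<open>F - {0}\<close> when the derivatives at \<open>a\<close> itself are sought, and all of
  \<open>F\<close> in the proof of injectivity.\<close>

lemma line_eq_zero:
  assumes "S \<subseteq> F" and "q - 1 \<le> card S"
    and "\<And>t u. t \<in> S \<Longrightarrow> u \<in> orders \<Longrightarrow> deriv_at f u (line_point a t v) = 0"
  shows "line f a v = 0"
proof (rule eq_zero_if_powers_dvd)
  show "finite S" using assms(1) finite_F by (rule finite_subset)
  show "[:-t, 1:] ^ m dvd line f a v" if "t \<in> S" for t
    using assms(3)[OF that]
    by (intro power_dvd_line_poly[OF exponents_subset])
       (auto simp: in_orders_iff deriv_at_line_point)
  have "degree (line f a v) < m * (q - 1)"
    using m q by (intro degree_line_poly) (auto simp: exponents_def)
  also have "\<dots> \<le> m * card S"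
    using assms(2) by simp
  finally show "degree (line f a v) < m * card S" .
qed

text \<open>The restrictions to the lines in the directions \<open>(1, v\<^sub>1, \<dots>)\<close> determine the homogeneous
  parts of the Taylor expansion at \<open>a\<close> on a grid, hence all derivatives of order less than \<open>m\<close>.\<close>

lemma recovery:
  assumes S: "\<And>i. i \<in> {1..<s} \<Longrightarrow> finite (S i)" "\<And>i. i \<in> {1..<s} \<Longrightarrow> m \<le> card (S i)"
    and vanish: "\<And>v t u. v 0 = 1 \<Longrightarrow> (\<And>i. i \<in> {1..<s} \<Longrightarrow> v i \<in> S i) \<Longrightarrow> t \<in> F - {0} \<Longrightarrow>
      u \<in> orders \<Longrightarrow> deriv_at f u (line_point a t v) = 0"
    and u: "u \<in> orders"
  shows "deriv_at f u a = 0"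
proof -
  define j where "j = (\<Sum>i<s. u i)"
  have ins: "{..<s} = insert 0 {1..<s}" using s by auto
  have j: "j < m" using u by (simp add: j_def orders_def)
  \<comment> \<open>Dehomogenisation: since \<open>v 0 = 1\<close>, the part of degree
    \<open>j\<close> is a polynomial in the variables \<open>1, ..., s - 1\<close>, and the exponent
    at 0 is what is missing to \<open>j\<close>. The value 0 for larger sums lets \<open>h\<close>
    live on the whole box that \<open>eq_zero_if_vanishes_on_grid\<close> expects.\<close>
  define h where "h e = (if (\<Sum>i=1..<s. e i) \<le> j then deriv_at f (e(0 := j - (\<Sum>i=1..<s. e i))) a else 0)"
    for e
  have split: "(\<Sum>i<s. e i) = e 0 + (\<Sum>i=1..<s. e i)" for e :: "nat \<Rightarrow> nat"
    unfolding ins by simp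
  have sum_upd: "(\<Sum>i=1..<s. (e(0 := y)) i) = (\<Sum>i=1..<s. e i)" for e :: "nat \<Rightarrow> nat" and y
    by (intro sum.cong) auto
  have "h (u(0 := undefined)) = 0"
  proof (rule eq_zero_if_vanishes_on_grid[of "{1..<s}" S m h, OF _ S])
    show "u(0 := undefined) \<in> {1..<s} \<rightarrow>\<^sub>E {..<m}"
      using u by (auto simp: orders_def PiE_iff extensional_def ins)
    fix w assume w: "w \<in> PiE {1..<s} S"
    define v where "v = w(0 := 1)"
    have v0: "v 0 = 1" by (simp add: v_def)
    have "line f a v = 0"
    proof (rule line_eq_zero[of "F - {0}"])
      show "q - 1 \<le> card (F - {0})"
        using zero card_F by simp
      show "deriv_at f u (line_point a t v) = 0" if "t \<in> F - {0}" "u \<in> orders" for t u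
        using w that by (intro vanish) (auto simp: v_def)
    qed auto
    then have "0 = coeff (line f a v) j" by simp
    also have "\<dots> = (\<Sum>e | e \<in> ({..<s} \<rightarrow>\<^sub>E {..<m * q}) \<and> (\<Sum>i<s. e i) = j.
        deriv_at f e a * (\<Prod>i<s. v i ^ e i))"
      by (rule coeff_line_poly[OF exponents_subset])
    \<comment> \<open>As \<open>j < m\<close>, all exponents in this sum are orders, hence below
      \<open>m\<close> in each variable. This is why grids of side \<open>m\<close> suffice.\<close>
    also have "{e. e \<in> ({..<s} \<rightarrow>\<^sub>E {..<m * q}) \<and> (\<Sum>i<s. e i) = j} = {e \<in> orders. (\<Sum>i<s. e i) = j}"
      using j by (auto simp: in_orders_iff)
    also have "(\<Sum>e | e \<in> orders \<and> (\<Sum>i<s. e i) = j. deriv_at f e a * (\<Prod>i<s. v i ^ e i)) =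
        (\<Sum>e | e \<in> ({1..<s} \<rightarrow>\<^sub>E {..<m}) \<and> (\<Sum>i=1..<s. e i) \<le> j. h e * (\<Prod>i=1..<s. w i ^ e i))"
    proof (rule sum.reindex_bij_witness[of _ "\<lambda>e. e(0 := j - (\<Sum>i=1..<s. e i))" "\<lambda>e. e(0 := undefined)"])
      fix e assume e: "e \<in> {e \<in> orders. (\<Sum>i<s. e i) = j}"
      have e0: "e 0 = j - (\<Sum>i=1..<s. e i)" and ej: "(\<Sum>i=1..<s. e i) \<le> j"
        using e split[of e] by auto
      show "(e(0 := undefined))(0 := j - (\<Sum>i=1..<s. (e(0 := undefined)) i)) = e"
        unfolding sum_upd e0[symmetric] by simp
      show "e(0 := undefined) \<in> {e. e \<in> ({1..<s} \<rightarrow>\<^sub>E {..<m}) \<and> (\<Sum>i=1..<s. e i) \<le> j}"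
        unfolding mem_Collect_eq sum_upd using e ej
        by (auto simp: orders_def PiE_iff extensional_def ins)
      have "(\<Prod>i<s. v i ^ e i) = (\<Prod>i=1..<s. v i ^ e i)"
        unfolding ins by (simp add: v0)
      also have "\<dots> = (\<Prod>i=1..<s. w i ^ (e(0 := undefined)) i)"
        by (intro prod.cong) (auto simp: v_def)
      finally have "(\<Prod>i<s. v i ^ e i) = (\<Prod>i=1..<s. w i ^ (e(0 := undefined)) i)" .
      moreover have "h (e(0 := undefined)) = deriv_at f e a"
        unfolding h_def sum_upd fun_upd_upd e0[symmetric] using ej by simp
      ultimately show "h (e(0 := undefined)) * (\<Prod>i=1..<s. w i ^ (e(0 := undefined)) i) =
          deriv_at f e a * (\<Prod>i<s. v i ^ e i)"
        by simp
    next
      fix e assume e: "e \<in> {e. e \<in> ({1..<s} \<rightarrow>\<^sub>E {..<m}) \<and> (\<Sum>i=1..<s. e i) \<le> j}"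
      then show "(e(0 := j - (\<Sum>i=1..<s. e i)))(0 := undefined) = e"
        by (auto simp: PiE_iff extensional_def)
      show "e(0 := j - (\<Sum>i=1..<s. e i)) \<in> {e \<in> orders. (\<Sum>i<s. e i) = j}"
        using e j unfolding orders_def mem_Collect_eq split sum_upd
        by (auto simp: PiE_iff extensional_def ins)
    qed
    also have "\<dots> = (\<Sum>e\<in>{1..<s} \<rightarrow>\<^sub>E {..<m}. h e * (\<Prod>i=1..<s. w i ^ e i))"
      by (rule sum.mono_neutral_left) (auto simp: h_def intro!: finite_PiE)
    finally show "(\<Sum>e\<in>{1..<s} \<rightarrow>\<^sub>E {..<m}. h e * (\<Prod>i=1..<s. w i ^ e i)) = 0" by simp
  qed auto
  moreover have u0: "j - (\<Sum>i=1..<s. u i) = u 0" and "(\<Sum>i=1..<s. u i) \<le> j"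
    using split[of u] by (auto simp: j_def)
  ultimately show ?thesis
    unfolding h_def sum_upd fun_upd_upd u0 by simp
qed

text \<open>If all derivatives vanish then \<open>f\<close> vanishes on all lines \<open>a + t v\<close> with \<open>a, v\<close> over \<open>F\<close>,
  even for a parameter \<open>t\<close> outside \<open>F\<close>.  Hence it vanishes on the \<open>s\<close>-th power
  of \<open>F + t F\<close>, a set of \<open>q\<^sup>2\<close> elements.\<close>

lemma eq_zero_if_derivs_vanish:
  assumes "\<And>a u. a \<in> points \<Longrightarrow> u \<in> orders \<Longrightarrow> deriv_at f u a = 0" and c: "c \<in> exponents"
  shows "f c = 0"
proof -
  obtain t where t: "t \<notin> F" using proper by auto
  define W where "W = (\<lambda>(x, z). x + t * z) ` (F \<times> F)"
  have "inj_on (\<lambda>(x, z). x + t * z) (F \<times> F)"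
  proof (rule inj_onI, clarify)
    fix x z x' z' assume F: "x \<in> F" "z \<in> F" "x' \<in> F" "z' \<in> F" and eq: "x + t * z = x' + t * z'"
    have zz: "z = z'"
    proof (rule ccontr)
      assume "z \<noteq> z'"
      have "t * (z - z') = x' - x" using eq by (simp add: algebra_simps)
      then have "t = (x' - x) * inverse (z - z')"
        using \<open>z \<noteq> z'\<close> by (simp add: field_simps)
      then show False using t F by (auto intro: mult diff inverse)
    qed
    then show "x = x' \<and> z = z'" using eq by simp
  qed
  then have W: "card W = q * q"
    by (simp add: W_def card_image card_cartesian_product card_F)
  define h where "h c = (if c \<in> exponents then f c else 0)" for c
  have "h c = 0"
  proof (rule eq_zero_if_vanishes_on_grid[of "{..<s}" "\<lambda>_. W" "m * q" h c])
    show "finite W" unfolding W_def using finite_F by blast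
    show "m * q \<le> card W" using m W by simp
    show "c \<in> {..<s} \<rightarrow>\<^sub>E {..<m * q}" using c exponents_subset by blast
    fix y assume y: "y \<in> {..<s} \<rightarrow>\<^sub>E W"
    have "\<forall>i\<in>{..<s}. \<exists>p. p \<in> F \<times> F \<and> y i = fst p + t * snd p"
      using y by (force simp: PiE_iff W_def)
    from bchoice[OF this] obtain p where
      p: "\<And>i. i < s \<Longrightarrow> p i \<in> F \<times> F \<and> y i = fst (p i) + t * snd (p i)" by auto
    define a where "a = restrict (\<lambda>i. fst (p i)) {..<s}"
    define v where "v = restrict (\<lambda>i. snd (p i)) {..<s}"
    have av: "a \<in> points" "\<And>i. i < s \<Longrightarrow> v i \<in> F"
      using p by (auto simp: a_def v_def points_def mem_Times_iff)
    have "line f a v = 0"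
      by (rule line_eq_zero[of F]) (use assms(1) line_point_in_points[OF av] card_F in auto)
    then have "0 = poly (line f a v) t" by simp
    also have "\<dots> = (\<Sum>c\<in>exponents. f c * (\<Prod>i<s. (a i + t * v i) ^ c i))"
      by (rule poly_line_poly)
    also have "\<dots> = (\<Sum>c\<in>exponents. h c * (\<Prod>i<s. y i ^ c i))"
      using p by (intro sum.cong arg_cong2[of _ _ _ _ "(*)"] prod.cong)
        (auto simp: h_def a_def v_def)
    also have "\<dots> = (\<Sum>c\<in>{..<s} \<rightarrow>\<^sub>E {..<m * q}. h c * (\<Prod>i<s. y i ^ c i))"
      using exponents_subset
      by (intro sum.mono_neutral_left) (auto simp: h_def intro!: finite_PiE)
    finally show "(\<Sum>c\<in>{..<s} \<rightarrow>\<^sub>E {..<m * q}. h c * (\<Prod>i<s. y i ^ c i)) = 0" by simp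
  qed auto
  then show ?thesis using c by (simp add: h_def)
qed

text \<open>An enumeration of \<open>F\<close> is cut into blocks of \<open>m\<close> consecutive
  elements. Products of \<open>s - 1\<close> such blocks will be the grids of directions.\<close>

lemma disjoint_direction_grids:
  obtains S :: "nat \<Rightarrow> 'a set" where "\<And>w. w < q div m \<Longrightarrow> S w \<subseteq> F"
    and "\<And>w. w < q div m \<Longrightarrow> card (S w) = m"
    and "\<And>w w'. w < q div m \<Longrightarrow> w' < q div m \<Longrightarrow> w \<noteq> w' \<Longrightarrow> S w \<inter> S w' = {}"
proof -
  obtain \<phi> where \<phi>: "bij_betw \<phi> {..<q} F"
    using ex_bij_betw_nat_finite[OF finite_F] card_F by (auto simp: atLeast0LessThan)
  define I where "I w = {w * m..<w * m + m}" for w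
  have sub: "I w \<subseteq> {..<q}" if "w < q div m" for w
  proof -
    have "(w + 1) * m \<le> q div m * m"
      using that by (intro mult_right_mono) auto
    also have "\<dots> \<le> q" by (rule div_times_less_eq_dividend)
    finally show ?thesis by (auto simp: I_def)
  qed
  have div: "x div m = w" if "x \<in> I w" for x w
  proof -
    have "x = w * m + (x - w * m)" "x - w * m < m" using that by (auto simp: I_def)
    then show ?thesis by (metis div_mult_self3 div_less add_0_right less_nat_zero_code)
  qed
  show thesis
  proof (rule that[of "\<lambda>w. \<phi> ` I w"])
    fix w assume w: "w < q div m"
    show "\<phi> ` I w \<subseteq> F"
      using \<phi> sub[OF w] by (auto simp: bij_betw_def)
    have "card (\<phi> ` I w) = card (I w)"
      using \<phi> sub[OF w] by (intro card_image) (auto simp: bij_betw_def intro: inj_on_subset)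
    then show "card (\<phi> ` I w) = m" by (simp add: I_def)
    fix w' assume w': "w' < q div m" "w \<noteq> w'"
    have "I w \<inter> I w' = {}" using div w'(2) by blast
    then show "\<phi> ` I w \<inter> \<phi> ` I w' = {}"
      using \<phi> sub[OF w] sub[OF w'(1)] inj_on_image_Int[of \<phi> "{..<q}" "I w" "I w'"]
      by (simp add: bij_betw_def)
  qed
qed

text \<open>A coordinate is one bit \<open>b\<close> of one derivative \<open>u\<close> at one point
  \<open>a\<close>. Its recovery sets depend on \<open>a\<close> only: for each choice
  \<open>g\<close> of one block per direction coordinate, all bits at the points other than
  \<open>a\<close> on the lines through \<open>a\<close> with directions in that grid. Lines with
  different directions \<open>(1, v 1, ...)\<close> meet only in \<open>a\<close>, so these sets are
  disjoint.\<close>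

lemma has_PIR_code_multiplicity_code:
  assumes l: "q = 2 ^ l" and n: "n \<le> l * card exponents"
  shows "has_PIR_code (n + l * (q ^ s * card orders - card exponents)) n ((q div m) ^ (s - 1))"
proof -
  obtain B :: "'a set" and \<rho> where "finite B" and cB: "card F = 2 ^ card B"
    and \<rho>B: "\<forall>x\<in>F. \<rho> x \<subseteq> B"
    and \<rho>_add: "\<forall>x\<in>F. \<forall>y\<in>F. \<rho> (x + y) = sym_diff (\<rho> x) (\<rho> y)"
    and \<rho>_0: "\<forall>x\<in>F. \<rho> x = {} \<longleftrightarrow> x = 0"
    using exists_binary_coordinates[OF double finite_F zero add] by auto
  have \<rho>_zero: "\<rho> 0 = {}"
    using \<rho>_0 zero by blast
  have cB: "card B = l"
    using cB card_F l by simp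
  obtain S where S: "\<And>w. w < q div m \<Longrightarrow> S w \<subseteq> F" "\<And>w. w < q div m \<Longrightarrow> card (S w) = m"
    "\<And>w w'. w < q div m \<Longrightarrow> w' < q div m \<Longrightarrow> w \<noteq> w' \<Longrightarrow> S w \<inter> S w' = {}"
    using disjoint_direction_grids by blast
  define P where "P = exponents \<rightarrow>\<^sub>E F"
  define J where "J = (points \<times> orders) \<times> B"
  define word where "word f = {((a, u), b). ((a, u), b) \<in> J \<and> b \<in> \<rho> (deriv_at f u a)}" for f
  define plus where "plus f g = restrict (\<lambda>c. f c + g c) exponents" for f g :: "(nat \<Rightarrow> nat) \<Rightarrow> 'a"
  define Q where "Q = {1..<s} \<rightarrow>\<^sub>E {..<q div m}"
  have plus: "plus f g \<in> P" if "f \<in> P" "g \<in> P" for f g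
    using that add by (auto simp: plus_def P_def PiE_iff)
  have in_F: "deriv_at f u a \<in> F" if "f \<in> P" "a \<in> points" for f u a
    using that deriv_at_in_F by (simp add: P_def)
  have word_plus: "word (plus f g) = sym_diff (word f) (word g)" if "f \<in> P" "g \<in> P" for f g
    using that by (auto simp: word_def J_def plus_def deriv_at_add \<rho>_add in_F)
  have vanish: "deriv_at f u a = 0"
    if "f \<in> P" "a \<in> points" "u \<in> orders" "\<And>b. b \<in> B \<Longrightarrow> ((a, u), b) \<notin> word f" for f u a
  proof -
    have "\<rho> (deriv_at f u a) = {}"
      using that \<rho>B in_F[of f a u] by (auto simp: word_def J_def)
    then show ?thesis using \<rho>_0 in_F that by blast
  qed
  have "inj_on word P"
  proof (rule inj_onI)
    fix f g assume fg: "f \<in> P" "g \<in> P" "word f = word g"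
    then have "word (plus f g) = {}" using word_plus by blast
    then have "deriv_at (plus f g) u a = 0" if "a \<in> points" "u \<in> orders" for a u
      using vanish[OF plus[OF fg(1,2)] that] by blast
    then have "plus f g c = 0" if "c \<in> exponents" for c
      using eq_zero_if_derivs_vanish that by blast
    then have "f c + g c = g c + g c" if "c \<in> exponents" for c
      using that double by (simp add: plus_def)
    then show "f = g"
      using fg unfolding P_def by (intro PiE_ext[of f exponents "\<lambda>_. F" g]) auto
  qed
  then have "card (word ` P) = card P" by (rule card_image)
  also have "\<dots> = q ^ card exponents"
    by (simp add: P_def card_PiE finite_exponents_set card_F)
  also have "\<dots> = 2 ^ (l * card exponents)"
    by (rule power_mult[of "2 :: nat" l "card exponents", folded l, symmetric])
  finally have card: "card (word ` P) = 2 ^ (l * card exponents)" .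
  have fin: "finite points" "finite orders"
    using finite_F by (auto simp: points_def orders_def intro: finite_PiE finite_exponents)
  have finJ: "finite J"
    using fin \<open>finite B\<close> by (simp add: J_def)
  have subJ: "word ` P \<subseteq> Pow J"
    by (auto simp: word_def)
  have empty: "{} \<in> word ` P"
  proof
    let ?z = "restrict (\<lambda>_. 0) exponents :: (nat \<Rightarrow> nat) \<Rightarrow> 'a"
    show "?z \<in> P" using zero by (auto simp: P_def)
    have "deriv_at ?z u a = 0" for u a by (simp add: hasse_def)
    then show "{} = word ?z" using \<rho>_zero by (simp add: word_def)
  qed
  have closed: "sym_diff A A' \<in> word ` P" if "A \<in> word ` P" "A' \<in> word ` P" for A A'
  proof -
    obtain f g where fg: "f \<in> P" "g \<in> P" "A = word f" "A' = word g"
      using \<open>A \<in> word ` P\<close> \<open>A' \<in> word ` P\<close> by blast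
    have "word (plus f g) \<in> word ` P"
      by (intro imageI plus fg)
    then show ?thesis
      by (simp only: fg word_plus)
  qed
  have recover: "\<exists>R. disjoint_family_on R Q \<and> (\<forall>g\<in>Q. \<forall>A\<in>word ` P. A \<inter> R g = {} \<longrightarrow> x \<notin> A)"
    if xJ: "x \<in> J" for x
  proof -
    obtain a u b where x: "x = ((a, u), b)" and a: "a \<in> points" and u: "u \<in> orders" and b: "b \<in> B"
      using xJ by (auto simp: J_def)
    define dir where "dir g = {v. v 0 = 1 \<and> (\<forall>i\<in>{1..<s}. v i \<in> S (g i))}" for g :: "nat \<Rightarrow> nat"
    \<comment> \<open>\<open>u'\<close> and \<open>b'\<close> range over all values; codewords are
      subsets of \<open>J\<close>, so only the coordinates in \<open>J\<close> matter.\<close>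
    define R where "R g = {((line_point a t v, u'), b') | t v (u' :: nat \<Rightarrow> nat) (b' :: 'a). t \<in> F - {0} \<and> v \<in> dir g}"
      for g :: "nat \<Rightarrow> nat"
    have "R g \<inter> R g' = {}" if g: "g \<in> Q" "g' \<in> Q" "g \<noteq> g'" for g g'
    proof (rule ccontr)
      assume "R g \<inter> R g' \<noteq> {}"
      then obtain t v t' v' where tv: "t \<in> F - {0}" "v \<in> dir g" "v' \<in> dir g'"
        and eq: "line_point a t v = line_point a t' v'"
        by (auto simp: R_def)
      have eq': "t * v i = t' * v' i" if "i < s" for i
        using fun_cong[OF eq, of i] that by (simp add: line_point_def)
      \<comment> \<open>Directions have entry 1 at coordinate 0, so this coordinate reads off the
        parameter; the others then give the direction, as \<open>t\<close> is nonzero.\<close>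
      have "t = t'" using eq'[of 0] tv s by (simp add: dir_def)
      obtain i where i: "i \<in> {1..<s}" "g i \<noteq> g' i"
        using g PiE_ext unfolding Q_def by metis
      have "v i = v' i" using eq'[of i] \<open>t = t'\<close> tv i by simp
      moreover have "v i \<in> S (g i)" "v' i \<in> S (g' i)" using tv i unfolding dir_def by blast+
      moreover have "g i < q div m" "g' i < q div m"
        using g i unfolding Q_def by (auto dest!: PiE_mem)
      ultimately show False using S(3)[of "g i" "g' i"] i by auto
    qed
    then have "disjoint_family_on R Q" by (auto simp: disjoint_family_on_def)
    moreover have "x \<notin> word f" if f: "f \<in> P" and g: "g \<in> Q" and disj: "word f \<inter> R g = {}" for f g
    proof -
      have gi: "g i < q div m" if "i \<in> {1..<s}" for i
        using g that unfolding Q_def by (auto dest!: PiE_mem)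
      have "deriv_at f u a = 0"
      proof (rule recovery[of "\<lambda>i. S (g i)"])
        fix v t u' assume v: "v 0 = (1 :: 'a)" "\<And>i. i \<in> {1..<s} \<Longrightarrow> v i \<in> S (g i)"
          and t: "t \<in> F - {0}" and u': "u' \<in> orders"
        have "v i \<in> F" if "i < s" for i
          using v one S(1)[OF gi, of i] that by (cases "i = 0") auto
        then have "line_point a t v \<in> points"
          using a t by (intro line_point_in_points) auto
        moreover have "v \<in> dir g"
          using v by (simp add: dir_def)
        then have "((line_point a t v, u'), b') \<in> R g" for b'
          using t unfolding R_def by blast
        ultimately show "deriv_at f u' (line_point a t v) = 0"
          using f u' disj by (intro vanish) blast+
      next
        fix i assume "i \<in> {1..<s}"
        then show "finite (S (g i))" "m \<le> card (S (g i))"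
          using S(1,2)[OF gi] finite_F by (auto intro: finite_subset)
      qed (rule u)
      then show ?thesis
        using \<rho>_zero by (simp add: x word_def)
    qed
    ultimately show ?thesis by blast
  qed
  have "finite Q"
    unfolding Q_def by (intro finite_PiE) auto
  note code = has_PIR_code_if_disjoint_recovery[OF finJ subJ empty closed card n recover this]
  have cJ: "card J = l * (q ^ s * card orders)"
    using fin by (simp add: J_def card_cartesian_product cB points_def card_PiE card_F)
  have cQ: "card Q = (q div m) ^ (s - 1)"
    by (simp add: Q_def card_PiE)
  show ?thesis
    using code unfolding cJ cQ by (simp add: right_diff_distrib')
qed

end

section \<open>The field with \<open>2 ^ l\<close> elements inside an algebraic closure, and its
  codes\<close>

lemma CHAR_gf2: "CHAR(gf2) = 2"
proof -
  have "(1 + 1 :: gf2) = 0" by transfer simp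
  then have "of_nat 2 = (0 :: gf2)" by simp
  then have "CHAR(gf2) dvd 2" by (simp only: of_nat_eq_0_iff_char_dvd)
  moreover have "CHAR(gf2) \<noteq> 1"
    using of_nat_CHAR[where 'a = gf2] by (metis of_nat_1 zero_neq_one)
  ultimately show ?thesis
    using prime_nat_iff two_is_prime_nat by blast
qed

text \<open>Closure under addition is the freshman's dream. The fixed points are not the whole
  closure, because the next power of the Frobenius map already fixes \<open>2 ^ (l + 1)\<close>
  elements.\<close>

lemma multiplicity_code_frobenius_fixed_points:
  assumes "1 \<le> l" and "1 \<le> s" and "1 \<le> m" and "m \<le> 2 ^ l"
  shows "multiplicity_code {x :: gf2 alg_closure. x ^ (2 ^ l) = x} (2 ^ l) s m"
proof -
  have char: "CHAR(gf2 alg_closure) = 2" by (simp add: CHAR_gf2)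
  then have dream: "(x + y) ^ (2 ^ l) = x ^ (2 ^ l) + y ^ (2 ^ l)" for x y :: "gf2 alg_closure"
    by (intro freshmans_dream') auto
  have card: "card {x :: gf2 alg_closure. x ^ (2 ^ l) = x} = 2 ^ l"
    using card_frobenius_fixed_points[where 'a = "gf2 alg_closure", of l] assms(1) char by simp
  show ?thesis
  proof
    show "card {x :: gf2 alg_closure. x ^ (2 ^ l) = x} = 2 ^ l"
      by (rule card)
    show "(2 :: nat) \<le> 2 ^ l"
      using assms(1) self_le_power[of "2 :: nat" l] by simp
    show "x + x = 0" for x :: "gf2 alg_closure"
    proof -
      have "(2 :: gf2 alg_closure) = of_nat CHAR(gf2 alg_closure)"
        by (simp only: char of_nat_numeral)
      then show ?thesis
        by (metis mult_2 mult_zero_left of_nat_CHAR)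
    qed
    show "{x :: gf2 alg_closure. x ^ (2 ^ l) = x} \<noteq> UNIV"
    proof
      assume "{x :: gf2 alg_closure. x ^ (2 ^ l) = x} = UNIV"
      then have UNIV: "card (UNIV :: gf2 alg_closure set) = 2 ^ l"
        using card by simp
      then have "finite (UNIV :: gf2 alg_closure set)"
        by (intro card_ge_0_finite) simp
      then have "card {x :: gf2 alg_closure. x ^ (2 ^ Suc l) = x} \<le> 2 ^ l"
        unfolding UNIV[symmetric] by (intro card_mono) auto
      then show False
        using card_frobenius_fixed_points[where 'a = "gf2 alg_closure", of "Suc l"] char by simp
    qed
  qed (use assms in \<open>auto simp: dream power_mult_distrib power_inverse\<close>)
qed

text \<open>Every order lies in \<open>low\<close> or in \<open>high\<close>. The low ones, taken at
  all points, are at most as many as the exponents, so the redundancy is paid for by the high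
  ones.\<close>

lemma exists_multiplicity_PIR_code:
  assumes "1 \<le> l" and "1 \<le> s" and "2 * s \<le> m" and "m \<le> 2 ^ l"
    and n: "real n \<le> real l * (2 ^ l * (real m / (2 * real s))) ^ s"
  shows "\<exists>r. has_PIR_code (n + r) n ((2 ^ l div m) ^ (s - 1)) \<and>
    r \<le> l * (s * ((2 ^ l) ^ s * m ^ (s - 1)))"
proof -
  define q :: nat where "q = 2 ^ l"
  have "multiplicity_code {x :: gf2 alg_closure. x ^ q = x} q s m"
    unfolding q_def by (rule multiplicity_code_frobenius_fixed_points) (use assms in auto)
  then interpret multiplicity_code "{x :: gf2 alg_closure. x ^ q = x}" q s m .
  define low where "low = {u \<in> {..<s} \<rightarrow>\<^sub>E {..<m}. (\<Sum>i<s. u i) + s < m}"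
  define high where "high = {u \<in> {..<s} \<rightarrow>\<^sub>E {..<m}. (\<Sum>i<s. u i) < m \<and> m \<le> (\<Sum>i<s. u i) + s}"
  have "orders \<subseteq> low \<union> high"
  proof
    fix u assume "u \<in> orders"
    then show "u \<in> low \<union> high"
      by (cases "(\<Sum>i<s. u i) + s < m") (simp_all add: orders_def low_def high_def)
  qed
  then have "card orders \<le> card (low \<union> high)"
    by (intro card_mono) (simp_all add: low_def high_def finite_exponents)
  also have "\<dots> \<le> card low + card high"
    by (rule card_Un_le)
  finally have "q ^ s * card orders \<le> q ^ s * card low + q ^ s * card high"
    by (metis distrib_left mult_le_mono2)
  moreover have low: "q ^ s * card low \<le> card exponents"
    unfolding low_def exponents_def using s m by (intro card_exponents_degree_ge) auto
  moreover have "q ^ s * card high \<le> q ^ s * (s * m ^ (s - 1))"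
    unfolding high_def using s by (intro mult_left_mono card_exponents_large_sum_le) auto
  ultimately have "q ^ s * card orders - card exponents \<le> q ^ s * (s * m ^ (s - 1))"
    by linarith
  then have "q ^ s * card orders - card exponents \<le> s * (q ^ s * m ^ (s - 1))"
    by (simp only: mult.left_commute)
  then have r: "l * (q ^ s * card orders - card exponents) \<le> l * (s * (q ^ s * m ^ (s - 1)))"
    by (rule mult_le_mono2)
  have "real n \<le> real l * (real (q ^ s) * (real m / (2 * real s)) ^ s)"
    using n by (simp add: q_def power_mult_distrib power_divide)
  also have "\<dots> \<le> real l * (real (q ^ s) * real (card low))"
    unfolding low_def using assms by (intro mult_left_mono card_exponents_small_sum_ge) auto
  also have "\<dots> = real l * real (q ^ s * card low)"
    by simp
  also have "\<dots> \<le> real l * real (card exponents)"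
    using low by (intro mult_left_mono of_nat_mono) auto
  finally have "n \<le> l * card exponents"
    by (simp flip: of_nat_mult)
  then show ?thesis
    using has_PIR_code_multiplicity_code[of l n] r unfolding q_def by blast
qed

subsection \<open>Choice of parameters\<close>

lemma half_le_floor:
  fixes x :: real
  assumes "1 \<le> x"
  shows "x / 2 \<le> real (nat \<lfloor>x\<rfloor>)" and "real (nat \<lfloor>x\<rfloor>) \<le> x"
proof -
  have "1 \<le> \<lfloor>x\<rfloor>" using assms by simp
  then have "real (nat \<lfloor>x\<rfloor>) = of_int \<lfloor>x\<rfloor>" "(1 :: real) \<le> of_int \<lfloor>x\<rfloor>"
    by simp_all
  then show "x / 2 \<le> real (nat \<lfloor>x\<rfloor>)" "real (nat \<lfloor>x\<rfloor>) \<le> x"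
    by linarith+
qed

text \<open>\<open>x\<close> is a real target for the field size: \<open>q\<close> is the least
  power of two not below \<open>x\<close>, hence at most \<open>2 * x\<close>, and \<open>m\<close>
  is the integer part of \<open>q powr \<alpha>\<close>. The factor \<open>4 * s\<close> combines a
  2 from rounding \<open>m\<close> down with the \<open>2 * s\<close> of the cube estimate. The 2 in
  the bound on \<open>k\<close> comes from rounding in \<open>q div m\<close>.\<close>

lemma exists_PIR_code_scaled:
  fixes s n :: nat and \<alpha> x :: real
  assumes s: "2 \<le> s" and \<alpha>: "0 < \<alpha>" "\<alpha> < 1" and x: "1 < x" "4 * real s \<le> x powr \<alpha>"
    and n: "real n \<le> log 2 x * (x powr (1 + \<alpha>) / (4 * real s)) ^ s"
    and k: "real k \<le> (x powr (1 - \<alpha>) / 2) ^ (s - 1)"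
  shows "\<exists>r. has_PIR_code (n + r) n k \<and>
    real r \<le> log 2 (2 * x) * (real s * (2 * x) powr (real s + \<alpha> * (real s - 1)))"
proof -
  define l where "l = nat \<lceil>log 2 x\<rceil>"
  have "0 < log 2 x" using x by simp
  then have l: "log 2 x \<le> real l" "real l \<le> log 2 x + 1" "1 \<le> l"
    unfolding l_def by linarith+
  define q where "q = (2 :: real) ^ l"
  have "q = 2 powr real l" by (simp add: q_def powr_realpow)
  moreover have "2 powr log 2 x \<le> 2 powr real l" "2 powr real l \<le> 2 powr (log 2 x + 1)"
    using l by (intro powr_mono; simp)+
  ultimately have q: "x \<le> q" "q \<le> 2 * x"
    using x by (simp_all add: powr_add)
  have q1: "1 < q" using q x by simp
  define m where "m = nat \<lfloor>q powr \<alpha>\<rfloor>"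
  have "1 \<le> q powr \<alpha>" using q1 \<alpha> by (intro ge_one_powr_ge_zero) auto
  then have m: "q powr \<alpha> / 2 \<le> real m" "real m \<le> q powr \<alpha>"
    unfolding m_def by (rule half_le_floor)+
  have mq: "real m \<le> q"
    using m(2) powr_mono[of \<alpha> 1 q] q1 \<alpha> by simp
  have qq: "q = real (2 ^ l)" by (simp add: q_def)
  have mq': "m \<le> 2 ^ l" using mq unfolding qq by simp
  have x\<alpha>: "x powr \<alpha> \<le> q powr \<alpha>" using q x \<alpha> by (intro powr_mono2) auto
  have m2s: "2 * s \<le> m" using x(2) x\<alpha> m by linarith
  have "real n \<le> real l * (2 ^ l * (real m / (2 * real s))) ^ s"
  proof -
    have "x powr (1 + \<alpha>) / (4 * real s) \<le> q powr (1 + \<alpha>) / (4 * real s)"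
      using q x \<alpha> by (intro divide_right_mono powr_mono2) auto
    also have "\<dots> = q * ((q powr \<alpha> / 2) / (2 * real s))"
      using q1 by (simp add: powr_add)
    also have "\<dots> \<le> q * (real m / (2 * real s))"
      using m q1 by (intro mult_left_mono divide_right_mono) auto
    finally have "(x powr (1 + \<alpha>) / (4 * real s)) ^ s \<le> (q * (real m / (2 * real s))) ^ s"
      by (intro power_mono) auto
    then have "log 2 x * (x powr (1 + \<alpha>) / (4 * real s)) ^ s \<le> real l * (q * (real m / (2 * real s))) ^ s"
      using l by (intro mult_mono) auto
    then show ?thesis using n by (simp add: q_def)
  qed
  then obtain r where r: "has_PIR_code (n + r) n ((2 ^ l div m) ^ (s - 1))"
      "r \<le> l * (s * ((2 ^ l) ^ s * m ^ (s - 1)))"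
    using exists_multiplicity_PIR_code[of l s m n] l s m2s mq' by auto
  have "k \<le> (2 ^ l div m) ^ (s - 1)"
  proof -
    have "m > 0" using m2s s by simp
    have "1 \<le> 2 ^ l div m"
      using div_le_mono[OF mq', of m] \<open>m > 0\<close> by simp
    have "2 ^ l < (2 ^ l div m + 1) * m"
      using dividend_less_div_times[OF \<open>m > 0\<close>, of "2 ^ l"] by (simp add: algebra_simps)
    also have "\<dots> \<le> (2 * (2 ^ l div m)) * m"
      using \<open>1 \<le> 2 ^ l div m\<close> by (intro mult_right_mono) auto
    finally have "real (2 ^ l) \<le> real (2 * (2 ^ l div m) * m)"
      by (intro of_nat_mono) simp
    then have "q \<le> 2 * real (2 ^ l div m) * real m"
      unfolding qq by simp
    also have "\<dots> \<le> 2 * real (2 ^ l div m) * q powr \<alpha>"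
      using m by (intro mult_left_mono) auto
    finally have "q / q powr \<alpha> \<le> 2 * real (2 ^ l div m)"
      using q1 by (simp add: divide_le_eq)
    then have "q powr (1 - \<alpha>) / 2 \<le> real (2 ^ l div m)"
      using q1 by (simp add: powr_diff)
    moreover have "x powr (1 - \<alpha>) \<le> q powr (1 - \<alpha>)"
      using q x \<alpha> by (intro powr_mono2) auto
    ultimately have "(x powr (1 - \<alpha>) / 2) ^ (s - 1) \<le> real (2 ^ l div m) ^ (s - 1)"
      by (intro power_mono) auto
    then have "real k \<le> real ((2 ^ l div m) ^ (s - 1))"
      using k unfolding of_nat_power by linarith
    then show ?thesis by (simp only: of_nat_le_iff)
  qed
  then have code: "has_PIR_code (n + r) n k"
    using r(1) has_PIR_code_mono by blast
  have "real r \<le> real (l * (s * ((2 ^ l) ^ s * m ^ (s - 1))))"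
    using r(2) by (rule of_nat_mono)
  also have "\<dots> = real l * (real s * (q ^ s * real m ^ (s - 1)))"
    by (simp add: q_def)
  also have "\<dots> \<le> log 2 (2 * x) * (real s * (2 * x) powr (real s + \<alpha> * (real s - 1)))"
  proof (intro mult_mono)
    show "real l \<le> log 2 (2 * x)"
      using l x by (simp add: log_mult)
    have "q ^ s * real m ^ (s - 1) \<le> q ^ s * (q powr \<alpha>) ^ (s - 1)"
      using m q1 by (intro mult_left_mono power_mono) auto
    also have "\<dots> = q powr real s * q powr (\<alpha> * real (s - 1))"
      using q1 by (simp add: powr_realpow powr_powr flip: powr_realpow[of "q powr \<alpha>"])
    also have "\<dots> = q powr (real s + \<alpha> * (real s - 1))"
      using s by (simp add: powr_add of_nat_diff)
    also have "\<dots> \<le> (2 * x) powr (real s + \<alpha> * (real s - 1))"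
      using q q1 s \<alpha> by (intro powr_mono2) auto
    finally show "q ^ s * real m ^ (s - 1) \<le> (2 * x) powr (real s + \<alpha> * (real s - 1))" .
  qed (use x q1 in auto)
  finally show ?thesis using code by blast
qed

text \<open>\<open>x n\<close> solves \<open>n = log x * x powr (s * (1 + \<alpha>))\<close> up to
  constants. All \<open>k\<close> below the bound are covered, so the same estimate serves
  \<open>k\<close> of the full order and \<open>k\<close> of smaller order.\<close>

lemma eventually_PIR_code:
  fixes s :: nat and \<alpha> :: real
  assumes s: "2 \<le> s" and \<alpha>: "0 < \<alpha>" "\<alpha> < 1"
  defines "\<beta> \<equiv> (1 - 1 / real s) * (1 - \<alpha>) / (1 + \<alpha>)" and "\<delta> \<equiv> \<alpha> / (real s * (1 + \<alpha>))"
  shows "\<exists>c>0. \<exists>C. \<forall>\<^sub>F n in sequentially.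
    \<forall>k. real k \<le> c * (real n / log 2 (real n)) powr \<beta> \<longrightarrow>
      (\<exists>r. has_PIR_code (n + r) n k \<and> real r \<le> C * (real n powr (1 - \<delta>) * log 2 (real n) powr \<delta>))"
proof -
  define \<gamma> where "\<gamma> = 1 / (real s * (1 + \<alpha>))"
  have s1: "1 < real s * (1 + \<alpha>)"
    using s \<alpha> by (simp add: less_1_mult)
  have \<gamma>: "0 < \<gamma>" "\<gamma> < 1"
    unfolding \<gamma>_def using s1 by (simp_all add: divide_less_eq)
  \<comment> \<open>\<open>A\<close> makes up for two losses, the factor \<open>\<gamma> / 2\<close>
    between \<open>log 2 (x n)\<close> and \<open>log 2 n\<close> and the denominator
    \<open>(4 * s) ^ s\<close>, so that the lower bound for the dimension becomes exactly
    \<open>n\<close>.\<close>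
  define A where "A = 2 * (4 * real s) ^ s / \<gamma>"
  have A: "1 \<le> A"
  proof -
    have "1 \<le> (4 * real s) ^ s" using s by (intro one_le_power) simp
    then have "\<gamma> \<le> 2 * (4 * real s) ^ s" using \<gamma> by linarith
    then show ?thesis using \<gamma> by (simp add: A_def le_divide_eq)
  qed
  define y where "y n = real n / log 2 (real n)" for n :: nat
  define x where "x n = A * y n powr \<gamma>" for n
  define e where "e = real s + \<alpha> * (real s - 1)"
  define C where "C = real s * (2 * A) powr e"
  have ev1: "\<forall>\<^sub>F n in sequentially. 4 * real s \<le> y n powr (\<gamma> * \<alpha>)"
    unfolding y_def using \<gamma> \<alpha> by real_asymp
  \<comment> \<open>Crude, but enough for \<open>log 2 (y n)\<close> to be at least half of
    \<open>log 2 n\<close>.\<close>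
  have ev2: "\<forall>\<^sub>F n in sequentially. real n powr (1 / 2) \<le> y n"
    unfolding y_def by real_asymp
  have ev3: "\<forall>\<^sub>F n in sequentially. 2 * (A * real n powr \<gamma>) \<le> real n"
    using \<gamma> A by real_asymp
  have ev4: "\<forall>\<^sub>F n in sequentially. 2 < (n :: nat)"
    by (rule eventually_gt_at_top)
  have "\<forall>\<^sub>F n in sequentially. \<forall>k. real k \<le> (1 / 2) ^ (s - 1) * y n powr \<beta> \<longrightarrow>
      (\<exists>r. has_PIR_code (n + r) n k \<and> real r \<le> C * (real n powr (1 - \<delta>) * log 2 (real n) powr \<delta>))"
    using ev1 ev2 ev3 ev4
  proof eventually_elim
    case (elim n)
    define L where "L = log 2 (real n)"
    have L: "1 < L" using \<open>2 < n\<close> by (simp add: L_def less_log_iff)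
    have "1 < real n powr (1 / 2)"
      using \<open>2 < n\<close> by (intro gr_one_powr) auto
    then have y1: "1 < y n" using elim by linarith
    have y: "y n = real n / L" "y n \<le> real n"
      using L \<open>2 < n\<close> by (simp_all add: y_def L_def divide_le_eq mult_le_cancel_left1)
    have yx: "y n powr \<gamma> \<le> x n" using A by (simp add: x_def mult_le_cancel_right1)
    have "1 < y n powr \<gamma>" using y1 \<gamma> by (intro gr_one_powr) auto
    then have x1: "1 < x n" using yx by linarith
    have "y n powr (\<gamma> * \<alpha>) \<le> x n powr \<alpha>"
      unfolding powr_powr[symmetric] using yx \<alpha> by (intro powr_mono2) auto
    then have x2: "4 * real s \<le> x n powr \<alpha>" using elim by linarith
    have "\<gamma> / 2 * L \<le> log 2 (x n)"
    proof -
      have "\<gamma> / 2 * L = \<gamma> * log 2 (real n powr (1 / 2))"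
        using \<open>2 < n\<close> by (simp add: L_def log_powr)
      also have "\<dots> \<le> \<gamma> * log 2 (y n)"
        using elim y1 \<gamma> \<open>2 < n\<close> by (intro mult_left_mono) auto
      also have "\<dots> = log 2 (y n powr \<gamma>)"
        using y1 by (simp add: log_powr)
      also have "\<dots> \<le> log 2 (x n)"
        using yx y1 x1 by (subst log_le_cancel_iff) auto
      finally show ?thesis .
    qed
    moreover have "A * y n / (4 * real s) ^ s \<le> (x n powr (1 + \<alpha>) / (4 * real s)) ^ s"
    proof -
      have "A * y n \<le> A powr (real s * (1 + \<alpha>)) * y n"
        using A s1 y1 powr_mono[of 1 "real s * (1 + \<alpha>)" A] by (intro mult_right_mono) auto
      also have "\<dots> = A powr (real s * (1 + \<alpha>)) * y n powr (\<gamma> * (real s * (1 + \<alpha>)))"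
        using s \<alpha> y1 by (simp add: \<gamma>_def)
      also have "\<dots> = x n powr (real s * (1 + \<alpha>))"
        using A y1 by (simp add: x_def powr_mult powr_powr)
      also have "\<dots> = (x n powr (1 + \<alpha>)) ^ s"
        using x1 by (simp add: powr_powr mult.commute flip: powr_realpow)
      finally show ?thesis
        by (simp add: power_divide divide_right_mono)
    qed
    ultimately have "\<gamma> / 2 * L * (A * y n / (4 * real s) ^ s) \<le>
        log 2 (x n) * (x n powr (1 + \<alpha>) / (4 * real s)) ^ s"
      using \<gamma> L A y1 x1 by (intro mult_mono) auto
    moreover have "\<gamma> / 2 * L * (A * y n / (4 * real s) ^ s) = real n"
      using \<gamma> s L by (simp add: A_def y)
    ultimately have n: "real n \<le> log 2 (x n) * (x n powr (1 + \<alpha>) / (4 * real s)) ^ s"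
      by simp
    show ?case
    proof (intro allI impI)
      fix k assume kle: "real k \<le> (1 / 2) ^ (s - 1) * y n powr \<beta>"
      have k: "real k \<le> (x n powr (1 - \<alpha>) / 2) ^ (s - 1)"
      proof -
        have "\<beta> = \<gamma> * ((1 - \<alpha>) * real (s - 1))"
          using s \<alpha> by (simp add: \<beta>_def \<gamma>_def of_nat_diff field_simps)
        then have "y n powr \<beta> = ((y n powr \<gamma>) powr (1 - \<alpha>)) ^ (s - 1)"
          using y1 by (simp add: powr_powr mult.assoc flip: powr_realpow)
        also have "\<dots> \<le> (x n powr (1 - \<alpha>)) ^ (s - 1)"
          using yx \<alpha> by (intro power_mono powr_mono2) auto
        finally have "(1 / 2) ^ (s - 1) * y n powr \<beta> \<le> (1 / 2) ^ (s - 1) * (x n powr (1 - \<alpha>)) ^ (s - 1)"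
          by (intro mult_left_mono) auto
        then show ?thesis
          using kle by (simp add: power_divide)
      qed
      obtain r where r: "has_PIR_code (n + r) n k" "real r \<le> log 2 (2 * x n) * (real s * (2 * x n) powr e)"
        using exists_PIR_code_scaled[OF s \<alpha> x1 x2 n k] unfolding e_def by blast
      note r(2)
      also have "log 2 (2 * x n) * (real s * (2 * x n) powr e) \<le> L * (real s * (2 * x n) powr e)"
      proof (rule mult_right_mono)
        have "2 * x n \<le> 2 * (A * real n powr \<gamma>)"
          unfolding x_def using A y y1 \<gamma> by (intro mult_left_mono powr_mono2) auto
        then have "2 * x n \<le> real n" using elim by linarith
        then show "log 2 (2 * x n) \<le> L" unfolding L_def using x1 by simp
      qed auto
      also have "(2 * x n) powr e = (2 * A) powr e * y n powr (1 - \<delta>)"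
      proof -
        \<comment> \<open>Indeed \<open>e = s * (1 + \<alpha>) - \<alpha>\<close>.\<close>
        have "\<gamma> * e = 1 - \<delta>"
          using s \<alpha> s1 by (simp add: \<gamma>_def e_def \<delta>_def field_simps)
        then show ?thesis
          using A y1 by (simp add: x_def powr_mult powr_powr)
      qed
      also have "L * (real s * ((2 * A) powr e * y n powr (1 - \<delta>))) = C * (L * y n powr (1 - \<delta>))"
        by (simp add: C_def)
      also have "L * y n powr (1 - \<delta>) = real n powr (1 - \<delta>) * L powr \<delta>"
      proof -
        have "L * y n powr (1 - \<delta>) = real n powr (1 - \<delta>) * (L powr 1 / L powr (1 - \<delta>))"
          using L by (simp add: y powr_divide)
        also have "L powr 1 / L powr (1 - \<delta>) = L powr \<delta>"
          unfolding powr_diff[symmetric] by simp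
        finally show ?thesis .
      qed
      finally show "\<exists>r. has_PIR_code (n + r) n k \<and>
          real r \<le> C * (real n powr (1 - \<delta>) * log 2 (real n) powr \<delta>)"
        using r(1) unfolding L_def by blast
    qed
  qed
  then show ?thesis
    unfolding y_def by (intro exI[of _ "(1 / 2) ^ (s - 1)"] exI[of _ C] conjI) auto
qed

section \<open>From estimates to families of codes\<close>

text \<open>Taking the least redundancy at each \<open>n\<close> yields one length function for all
  \<open>n\<close>; its values matter only where a code exists.\<close>

lemma exists_code_lengths:
  assumes "\<forall>\<^sub>F n in sequentially. \<exists>r. has_PIR_code (n + r) n (kf n) \<and> real r \<le> C * g n"
  shows "\<exists>Nf. (\<forall>\<^sub>F n in sequentially. has_PIR_code (Nf n) n (kf n)) \<and>
    (\<lambda>n. real (Nf n) - real n) \<in> O(g)"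
proof -
  define rf where "rf n = (LEAST r. has_PIR_code (n + r) n (kf n))" for n
  have "\<forall>\<^sub>F n in sequentially. has_PIR_code (n + rf n) n (kf n) \<and> real (rf n) \<le> C * g n"
    using assms
  proof eventually_elim
    case (elim n)
    then obtain r where r: "has_PIR_code (n + r) n (kf n)" "real r \<le> C * g n" by blast
    have "has_PIR_code (n + rf n) n (kf n)"
      unfolding rf_def using r(1) by (rule LeastI)
    moreover have "rf n \<le> r"
      unfolding rf_def using r(1) by (rule Least_le)
    ultimately show ?case using r(2) by linarith
  qed
  then have ev: "\<forall>\<^sub>F n in sequentially. has_PIR_code (n + rf n) n (kf n)"
    "\<forall>\<^sub>F n in sequentially. real (rf n) \<le> C * g n"
    by (auto elim: eventually_mono)
  have "(\<lambda>n. real (n + rf n) - real n) \<in> O(g)"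
  proof (rule bigoI[of _ "\<bar>C\<bar>"])
    show "\<forall>\<^sub>F n in sequentially. norm (real (n + rf n) - real n) \<le> \<bar>C\<bar> * norm (g n)"
      using ev(2)
    proof eventually_elim
      case (elim n)
      then have "real (rf n) \<le> \<bar>C * g n\<bar>" by linarith
      then show ?case by (simp add: abs_mult)
    qed
  qed
  then show ?thesis using ev(1) by (intro exI[of _ "\<lambda>n. n + rf n"]) auto
qed

lemma floor_bigtheta:
  fixes g :: "nat \<Rightarrow> real"
  assumes "\<forall>\<^sub>F n in sequentially. 1 \<le> g n"
  shows "(\<lambda>n. real (nat \<lfloor>g n\<rfloor>)) \<in> \<Theta>(g)"
proof (rule bigthetaI)
  show "(\<lambda>n. real (nat \<lfloor>g n\<rfloor>)) \<in> O(g)"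
    by (rule bigoI[of _ 1]) (use assms in \<open>eventually_elim, simp add: half_le_floor\<close>)
  show "(\<lambda>n. real (nat \<lfloor>g n\<rfloor>)) \<in> \<Omega>(g)"
  proof (rule landau_omega.bigI[of "1 / 2"])
    show "\<forall>\<^sub>F n in sequentially. 1 / 2 * norm (g n) \<le> norm (real (nat \<lfloor>g n\<rfloor>))"
      using assms
    proof eventually_elim
      case (elim n)
      then show ?case using half_le_floor(1)[OF elim] by simp
    qed
  qed simp
qed

text \<open>Serves the case \<open>\<epsilon> = 0\<close> of \<open>PIR_codes_delta\<close>, where
  the construction would require \<alpha> = 1.\<close>

lemma has_PIR_code_identity: "has_PIR_code n n 1"
proof -
  have enc: "encode (\<lambda>j. {j}) x j = x j" for x :: "nat \<Rightarrow> bool" and j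
  proof -
    have "{i \<in> {j}. x i} = (if x j then {j} else {})" by auto
    then show ?thesis by (simp add: encode_def)
  qed
  have "is_PIR_code n n 1 (\<lambda>j. {j})"
    unfolding is_PIR_code_def
  proof (intro conjI allI impI ballI)
    fix x y assume "x \<in> messages n" "y \<in> messages n"
      "\<forall>j<n. encode (\<lambda>j. {j}) x j = encode (\<lambda>j. {j}) y j"
    then show "x = y"
      unfolding enc messages_def by (intro ext) (metis mem_Collect_eq not_le)
  next
    fix i assume "i < n"
    then show "\<exists>R :: nat \<Rightarrow> nat set. (\<forall>t<1. R t \<subseteq> {..<n} \<and> recovers n (\<lambda>j. {j}) i (R t)) \<and>
        (\<forall>t<1. \<forall>t'<1. t \<noteq> t' \<longrightarrow> R t \<inter> R t' = {})"
      by (intro exI[of _ "\<lambda>_. {i}"]) (auto simp: recovers_def enc)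
  qed auto
  then show ?thesis unfolding has_PIR_code_def by blast
qed

text \<open>Every admissible value is less than 1, while \<open>delta_s s \<epsilon>\<close> tends
  to 1 as \<open>s\<close> grows. So only finitely many \<open>s\<close> compete with a given one,
  and the infimum is a minimum.\<close>

lemma delta_attained:
  assumes "0 \<le> \<epsilon>" and "\<epsilon> < 1"
  shows "\<exists>s. real s > 1 / (1 - \<epsilon>) \<and> delta \<epsilon> = delta_s s \<epsilon>"
proof -
  define V where "V = {s. real s > 1 / (1 - \<epsilon>)}"
  obtain s0 where s0: "s0 \<in> V"
    using reals_Archimedean2[of "1 / (1 - \<epsilon>)"] by (auto simp: V_def)
  have "1 \<le> 1 / (1 - \<epsilon>)" using assms by (simp add: le_divide_eq)
  then have "1 < real s0"
    using s0 unfolding V_def mem_Collect_eq by linarith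
  moreover have "1 < real s0 * (1 - \<epsilon>)"
    using s0 assms by (simp add: V_def divide_less_eq)
  ultimately have "delta_s s0 \<epsilon> < 1"
    by (simp add: delta_s_def)
  moreover have "(\<lambda>s. delta_s s \<epsilon>) \<longlonglongrightarrow> 1"
    unfolding delta_s_def by real_asymp
  ultimately have "\<forall>\<^sub>F s in sequentially. delta_s s0 \<epsilon> < delta_s s \<epsilon>"
    by (simp add: order_tendsto_iff)
  then obtain M where M: "\<And>s. s \<ge> M \<Longrightarrow> delta_s s0 \<epsilon> < delta_s s \<epsilon>"
    unfolding eventually_sequentially by blast
  have "s0 \<in> V \<inter> {..<M}"
    using s0 M[of s0] by (auto simp: not_le[symmetric])
  then have fin: "finite (V \<inter> {..<M})" "V \<inter> {..<M} \<noteq> {}" by auto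
  define t where "t = arg_min_on (\<lambda>s. delta_s s \<epsilon>) (V \<inter> {..<M})"
  have t: "t \<in> V" and min: "\<And>s. s \<in> V \<inter> {..<M} \<Longrightarrow> delta_s t \<epsilon> \<le> delta_s s \<epsilon>"
    using arg_min_if_finite[OF fin, of "\<lambda>s. delta_s s \<epsilon>"] by (auto simp: t_def not_less)
  have "delta_s t \<epsilon> \<le> delta_s s \<epsilon>" if "s \<in> V" for s
    using min[of s] min[OF \<open>s0 \<in> V \<inter> {..<M}\<close>] M[of s] that by (cases "s < M") auto
  then have "Inf {delta_s s \<epsilon> | s. real s > 1 / (1 - \<epsilon>)} = delta_s t \<epsilon>"
    using t by (intro cInf_eq_minimum) (auto simp: V_def)
  then show ?thesis
    using t by (auto simp: delta_def V_def)
qed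

text \<open>The map sending \<alpha> to \<open>(1 - \<alpha>) / (1 + \<alpha>)\<close> is its own
  inverse, so the equation for \<epsilon> is solved by applying it to
  \<open>a = \<epsilon> * s / (s - 1)\<close>. The condition on \<open>s\<close> says exactly that
  \<open>a < 1\<close>.\<close>

lemma parameter_for_exponent:
  assumes \<epsilon>: "0 < \<epsilon>" "\<epsilon> < 1" and s: "real s > 1 / (1 - \<epsilon>)"
  obtains \<alpha> :: real where "2 \<le> s" and "0 < \<alpha>" and "\<alpha> < 1"
    and "(1 - 1 / real s) * (1 - \<alpha>) / (1 + \<alpha>) = \<epsilon>"
    and "1 - \<alpha> / (real s * (1 + \<alpha>)) = delta_s s \<epsilon>"
proof -
  have "1 < 1 / (1 - \<epsilon>)" using \<epsilon> by (simp add: less_divide_eq)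
  then have s1: "1 < real s" using s by linarith
  have "1 < real s * (1 - \<epsilon>)" using s \<epsilon> by (simp add: divide_less_eq)
  then have es: "\<epsilon> * real s < real s - 1" by (simp add: algebra_simps)
  define a where "a = \<epsilon> * real s / (real s - 1)"
  have a: "0 < a" "a < 1"
    using \<epsilon> s1 es by (simp_all add: a_def divide_less_eq)
  define \<alpha> where "\<alpha> = (1 - a) / (1 + a)"
  have \<alpha>1: "(1 - \<alpha>) / (1 + \<alpha>) = a" "\<alpha> / (1 + \<alpha>) = (1 - a) / 2"
    using a by (simp_all add: \<alpha>_def field_simps)
  show thesis
  proof (rule that[of \<alpha>])
    show "2 \<le> s" using s1 by simp
    show "0 < \<alpha>" "\<alpha> < 1" using a by (simp_all add: \<alpha>_def divide_less_eq)
    have "(1 - 1 / real s) * (1 - \<alpha>) / (1 + \<alpha>) = (1 - 1 / real s) * a"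
      using \<alpha>1(1) by (metis times_divide_eq_right)
    also have "\<dots> = \<epsilon>"
      using s1 by (simp add: a_def field_simps)
    finally show "(1 - 1 / real s) * (1 - \<alpha>) / (1 + \<alpha>) = \<epsilon>" .
    have "\<alpha> / (real s * (1 + \<alpha>)) = (\<alpha> / (1 + \<alpha>)) / real s"
      by (simp add: mult.commute)
    also have "\<dots> = (1 - a) / 2 / real s"
      unfolding \<alpha>1(2) ..
    also have "\<dots> = (real s * (1 - \<epsilon>) - 1) / (2 * real s * (real s - 1))"
      using s1 by (simp add: a_def divide_simps) (simp add: algebra_simps)
    finally show "1 - \<alpha> / (real s * (1 + \<alpha>)) = delta_s s \<epsilon>"
      by (simp add: delta_s_def)
  qed
qed

lemma PIR_codes_of_parameters:
  fixes s :: nat and \<alpha> :: real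
  assumes "2 \<le> s" and "0 < \<alpha>" and "\<alpha> < 1"
  defines "\<beta> \<equiv> (1 - 1 / real s) * (1 - \<alpha>) / (1 + \<alpha>)" and "\<delta> \<equiv> \<alpha> / (real s * (1 + \<alpha>))"
  shows "\<exists>kf Nf :: nat \<Rightarrow> nat.
    (\<forall>\<^sub>F n in sequentially. has_PIR_code (Nf n) n (kf n)) \<and>
    (\<lambda>n. real (kf n)) \<in> \<Theta>(\<lambda>n. (real n / log 2 (real n)) powr \<beta>) \<and>
    (\<lambda>n. real (Nf n) - real n) \<in> O(\<lambda>n. real n powr (1 - \<delta>) * log 2 (real n) powr \<delta>)"
proof -
  obtain c C where c: "c > 0" and ev: "\<forall>\<^sub>F n in sequentially.
    \<forall>k. real k \<le> c * (real n / log 2 (real n)) powr \<beta> \<longrightarrow>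
      (\<exists>r. has_PIR_code (n + r) n k \<and> real r \<le> C * (real n powr (1 - \<delta>) * log 2 (real n) powr \<delta>))"
    using eventually_PIR_code[OF assms(1-3)] unfolding \<beta>_def \<delta>_def by blast
  define g where "g n = c * (real n / log 2 (real n)) powr \<beta>" for n :: nat
  have "0 < \<beta>"
    using assms by (simp add: \<beta>_def)
  then have g1: "\<forall>\<^sub>F n in sequentially. 1 \<le> g n"
    unfolding g_def using c by real_asymp
  have "\<forall>\<^sub>F n in sequentially. \<exists>r. has_PIR_code (n + r) n (nat \<lfloor>g n\<rfloor>) \<and>
      real r \<le> C * (real n powr (1 - \<delta>) * log 2 (real n) powr \<delta>)"
    using ev g1
  proof eventually_elim
    case (elim n)
    then show ?case using half_le_floor(2)[OF elim(2)] by (simp add: g_def)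
  qed
  from exists_code_lengths[OF this] obtain Nf where
    "\<forall>\<^sub>F n in sequentially. has_PIR_code (Nf n) n (nat \<lfloor>g n\<rfloor>)"
    "(\<lambda>n. real (Nf n) - real n) \<in> O(\<lambda>n. real n powr (1 - \<delta>) * log 2 (real n) powr \<delta>)"
    by blast
  moreover have "(\<lambda>n. real (nat \<lfloor>g n\<rfloor>)) \<in> \<Theta>(\<lambda>n. (real n / log 2 (real n)) powr \<beta>)"
    using floor_bigtheta[OF g1] c unfolding g_def by simp
  ultimately show ?thesis
    by (intro exI[of _ "\<lambda>n. nat \<lfloor>g n\<rfloor>"] exI[of _ Nf]) simp
qed

lemma PIR_codes_delta:
  assumes "0 \<le> \<epsilon>" and "\<epsilon> < 1"
  shows "\<exists>kf Nf :: nat \<Rightarrow> nat.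
    (\<forall>\<^sub>F n in sequentially. has_PIR_code (Nf n) n (kf n)) \<and>
    (\<forall>\<tau>>0. (\<lambda>n. real (kf n)) \<in> \<Omega>(\<lambda>n. real n powr (\<epsilon> - \<tau>))) \<and>
    (\<forall>\<tau>>0. (\<lambda>n. real (Nf n) - real n) \<in> O(\<lambda>n. real n powr (delta \<epsilon> + \<tau>)))"
proof (cases "\<epsilon> = 0")
  case True
  have "(\<lambda>n. real 1) \<in> \<Omega>(\<lambda>n. real n powr (0 - \<tau>))" if "\<tau> > 0" for \<tau>
    using that by real_asymp
  then show ?thesis
    using has_PIR_code_identity True by (intro exI[of _ "\<lambda>_. 1"] exI[of _ "\<lambda>n. n"]) simp
next
  case False
  then have \<epsilon>: "0 < \<epsilon>" using assms by simp
  obtain s where s: "real s > 1 / (1 - \<epsilon>)" "delta \<epsilon> = delta_s s \<epsilon>"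
    using delta_attained[OF assms] by blast
  obtain \<alpha> where \<alpha>: "2 \<le> s" "0 < \<alpha>" "\<alpha> < 1" "(1 - 1 / real s) * (1 - \<alpha>) / (1 + \<alpha>) = \<epsilon>"
    and \<delta>: "1 - \<alpha> / (real s * (1 + \<alpha>)) = delta_s s \<epsilon>"
    using parameter_for_exponent[OF \<epsilon> assms(2) s(1)] by metis
  define \<delta> where "\<delta> = \<alpha> / (real s * (1 + \<alpha>))"
  have d: "delta \<epsilon> = 1 - \<delta>" using s(2) \<delta> by (simp add: \<delta>_def)
  obtain kf Nf :: "nat \<Rightarrow> nat" where code: "\<forall>\<^sub>F n in sequentially. has_PIR_code (Nf n) n (kf n)"
    and k: "(\<lambda>n. real (kf n)) \<in> \<Theta>(\<lambda>n. (real n / log 2 (real n)) powr \<epsilon>)"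
    and r: "(\<lambda>n. real (Nf n) - real n) \<in> O(\<lambda>n. real n powr (1 - \<delta>) * log 2 (real n) powr \<delta>)"
    using PIR_codes_of_parameters[OF \<alpha>(1-3)] unfolding \<alpha>(4) \<delta>_def by blast
  have "(\<lambda>n. real (kf n)) \<in> \<Omega>(\<lambda>n. real n powr (\<epsilon> - \<tau>))" if "\<tau> > 0" for \<tau>
  proof -
    have "(\<lambda>n. (real n / log 2 (real n)) powr \<epsilon>) \<in> \<Omega>(\<lambda>n. real n powr (\<epsilon> - \<tau>))"
      using that \<epsilon> by real_asymp
    with k show ?thesis
      using bigthetaD2 landau_omega.big_trans by blast
  qed
  moreover have "(\<lambda>n. real (Nf n) - real n) \<in> O(\<lambda>n. real n powr (delta \<epsilon> + \<tau>))" if "\<tau> > 0" for \<tau>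
  proof -
    have "(\<lambda>n. real n powr (1 - \<delta>) * log 2 (real n) powr \<delta>) \<in> O(\<lambda>n. real n powr (1 - \<delta> + \<tau>))"
      using that by real_asymp
    with r show ?thesis
      unfolding d using landau_o.big_trans by blast
  qed
  ultimately show ?thesis using code by blast
qed

text \<open>The construction is run at an exponent \<open>\<eta>\<close> strictly between \<epsilon>
  and 1. The gap absorbs the logarithm, so \<open>k\<close> can be lowered to the exact order
  \<open>n powr \<epsilon>\<close>, and the redundancy stays sublinear because
  \<open>\<delta>\<close> is positive.\<close>

lemma PIR_codes_sublinear:
  assumes "0 \<le> \<epsilon>" and "\<epsilon> < 1"
  shows "\<exists>kf Nf :: nat \<Rightarrow> nat.
    (\<forall>\<^sub>F n in sequentially. has_PIR_code (Nf n) n (kf n)) \<and>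
    (\<lambda>n. real (kf n)) \<in> \<Theta>(\<lambda>n. real n powr \<epsilon>) \<and>
    (\<lambda>n. real (Nf n) - real n) \<in> o(\<lambda>n. real n)"
proof -
  define \<eta> where "\<eta> = (1 + \<epsilon>) / 2"
  have \<eta>: "0 < \<eta>" "\<eta> < 1" "\<epsilon> < \<eta>" using assms by (simp_all add: \<eta>_def)
  obtain s where s: "1 / (1 - \<eta>) < real s" using reals_Archimedean2 by blast
  obtain \<alpha> where \<alpha>: "2 \<le> s" "0 < \<alpha>" "\<alpha> < 1" "(1 - 1 / real s) * (1 - \<alpha>) / (1 + \<alpha>) = \<eta>"
    using parameter_for_exponent[OF \<eta>(1,2) s] by metis
  define \<delta> where "\<delta> = \<alpha> / (real s * (1 + \<alpha>))"
  have \<delta>: "0 < \<delta>" using \<alpha> by (simp add: \<delta>_def)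
  obtain c C where c: "c > 0" and ev: "\<forall>\<^sub>F n in sequentially.
    \<forall>k. real k \<le> c * (real n / log 2 (real n)) powr \<eta> \<longrightarrow>
      (\<exists>r. has_PIR_code (n + r) n k \<and> real r \<le> C * (real n powr (1 - \<delta>) * log 2 (real n) powr \<delta>))"
    using eventually_PIR_code[OF \<alpha>(1-3)] unfolding \<alpha>(4) \<delta>_def by blast
  have g1: "\<forall>\<^sub>F n in sequentially. 1 \<le> real n powr \<epsilon>"
    using eventually_ge_at_top[of 1]
    by eventually_elim (use assms in \<open>auto intro: ge_one_powr_ge_zero\<close>)
  have "\<forall>\<^sub>F n in sequentially. real n powr \<epsilon> \<le> c * (real n / log 2 (real n)) powr \<eta>"
    using \<eta> c by real_asymp
  with ev g1 have "\<forall>\<^sub>F n in sequentially. \<exists>r. has_PIR_code (n + r) n (nat \<lfloor>real n powr \<epsilon>\<rfloor>) \<and>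
      real r \<le> C * (real n powr (1 - \<delta>) * log 2 (real n) powr \<delta>)"
  proof eventually_elim
    case (elim n)
    have "real (nat \<lfloor>real n powr \<epsilon>\<rfloor>) \<le> c * (real n / log 2 (real n)) powr \<eta>"
      using half_le_floor(2)[OF elim(2)] elim(3) by linarith
    then show ?case using elim(1) by blast
  qed
  from exists_code_lengths[OF this] obtain Nf where
    code: "\<forall>\<^sub>F n in sequentially. has_PIR_code (Nf n) n (nat \<lfloor>real n powr \<epsilon>\<rfloor>)"
    and r: "(\<lambda>n. real (Nf n) - real n) \<in> O(\<lambda>n. real n powr (1 - \<delta>) * log 2 (real n) powr \<delta>)"
    by blast
  have "(\<lambda>n. real n powr (1 - \<delta>) * log 2 (real n) powr \<delta>) \<in> o(\<lambda>n. real n)"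
    using \<delta> by real_asymp
  with r have "(\<lambda>n. real (Nf n) - real n) \<in> o(\<lambda>n. real n)"
    by (rule landau_o.big_small_trans)
  then show ?thesis
    using code floor_bigtheta[OF g1] by (intro exI[of _ "\<lambda>n. nat \<lfloor>real n powr \<epsilon>\<rfloor>"] exI[of _ Nf]) simp
qed

theorem theorem4:
  shows
  "(\<forall>s::nat. \<forall>\<alpha>::real. s \<ge> 2 \<and> 0 < \<alpha> \<and> \<alpha> < 1 \<longrightarrow>
     (\<exists>kf Nf :: nat \<Rightarrow> nat.
        (\<forall>\<^sub>F n in sequentially. has_PIR_code (Nf n) n (kf n)) \<and>
        (\<lambda>n. real (kf n)) \<in>
          \<Theta>(\<lambda>n. (real n / log 2 (real n)) powr ((1 - 1 / real s) * (1 - \<alpha>) / (1 + \<alpha>))) \<and>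
        (\<lambda>n. real (Nf n) - real n) \<in>
          O(\<lambda>n. real n powr (1 - \<alpha> / (real s * (1 + \<alpha>)))
                 * log 2 (real n) powr (\<alpha> / (real s * (1 + \<alpha>))))))
   \<and>
   (\<forall>\<epsilon>::real. 0 \<le> \<epsilon> \<and> \<epsilon> < 1 \<longrightarrow>
     (\<exists>kf Nf :: nat \<Rightarrow> nat.
        (\<forall>\<^sub>F n in sequentially. has_PIR_code (Nf n) n (kf n)) \<and>
        (\<forall>\<tau>>0. (\<lambda>n. real (kf n)) \<in> \<Omega>(\<lambda>n. real n powr (\<epsilon> - \<tau>))) \<and>
        (\<forall>\<tau>>0. (\<lambda>n. real (Nf n) - real n) \<in> O(\<lambda>n. real n powr (delta \<epsilon> + \<tau>)))))
   \<and>
   (\<forall>\<epsilon>::real. 0 \<le> \<epsilon> \<and> \<epsilon> < 1 \<longrightarrow>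
     (\<exists>kf Nf :: nat \<Rightarrow> nat.
        (\<forall>\<^sub>F n in sequentially. has_PIR_code (Nf n) n (kf n)) \<and>
        (\<lambda>n. real (kf n)) \<in> \<Theta>(\<lambda>n. real n powr \<epsilon>) \<and>
        (\<lambda>n. real (Nf n) - real n) \<in> o(\<lambda>n. real n)))"
  using PIR_codes_of_parameters PIR_codes_delta PIR_codes_sublinear by blast

end
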